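(* Let $S:\mathbb T_+\times\mathcal X\to\mathcal X$ be a semi-dynamical system on a metric space $(\mathcal X,d)$ having a global attractor $\mathcal A$, and suppose that the hypotheses (H1)–(H4) and (V1)–(V5) listed in the context are fulfilled. Then the sets $\mathcal M_0,\dots,\mathcal M_{N_0}$ defined in the context form a Morse decomposition of the global attractor $\mathcal A$, for any integer $N_0>N^*$ in case $\mathcal O\neq\emptyset$, and for any $N_0\in\mathbb N_0$ in case $\mathcal O=\emptyset$.
   Context: Notation. $\mathbb N_0=\{0,1,2,\dots\}$, $\mathbb T\in\{\mathbb R,\mathbb Z\}$, $\mathbb T_+=\mathbb T\cap[0,\infty)$. $(\mathcal X,d)$ is a metric space; $S:\mathbb T_+\times\mathcal X\to\mathcal X$ is a (continuous) semi-dynamical system: $S(0,\cdot)=\mathrm{id}$, $S(t+s,\xi)=S(t,S(s,\xi))$. A set $B$ is invariant if $S(t,B)=B$ for all $t\in\mathbb T_+$. The global attractor $\mathcal A$ is the maximal compact invariant set containing $\omega(B)=\bigcap_{t\in\mathbb T}\overline{\bigcup_{s\ge t}S(s,B)}$ for all bounded $B\subseteq\mathcal X$; it equals the union of the trajectories of all bounded entire solutions. An entire solution is a map $\varphi:\mathbb T\to\mathcal X$ with $\varphi(s+t)=S(t,\varphi(s))$ for all $s\in\mathbb T$, $t\in\mathbb T_+$; it is "through $\xi$" if $\varphi(0)=\xi$. For $\xi\in\mathcal X$, $\omega(\xi)$ is the set of all limits of $S(t_n,\xi)$ with $t_n\to\infty$; for an entire solution $\varphi$, $\alpha(\varphi)$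 is the set of all limits of $\varphi(t_n)$ with $t_n\to-\infty$. Morse decomposition of $\mathcal A$: a finite ordered collection $\mathcal M_0\prec\dots\prec\mathcal M_m$ of nonempty, compact, invariant, pairwise disjoint subsets of $\mathcal A$ such that for any $\xi\in\mathcal A$ and any bounded entire solution $\varphi$ through $\xi$ there exist $N\le K$ in $\{0,\dots,m\}$ with $\alpha(\varphi)\subseteq\mathcal M_K$, $\omega(\xi)\subseteq\mathcal M_N$, and such that $N=K$ implies $\varphi(t)\in\mathcal M_N$ for all $t\in\mathbb T$. By convention, when sets $\mathcal M_0,\dots,\mathcal M_m$ are listed as a Morse decomposition, some (but not all) of them may be empty. Hypotheses. (H1) $\mathcal O\subseteq\mathcal A$ is compact, and invariant in the sense that $S(t,\mathcal O)=\mathcal O$ for all $t\in\mathbb T_+$. (H2) $\widetilde{\mathcal X}\subseteq\mathcal X$ is positively invariant, i.e. $S(t,\widetilde{\mathcal X})\subseteq\widetilde{\mathcal X}$ for all $t\in\mathbb T_+$, and $\mathcal A\subseteq\widetilde{\mathcal X}$. (H3) A metric $\widetilde d$ is defined on $\widetilde{\mathcal X}$ such that for any $\xi\in\widetilde{\mathcal X}$ and any sequence $(\xi_n)$ in $\widetilde{\mathcal X}$, $\widetilde d(\xi_n,\xi)\to0$ implies $d(\xi_n,\xi)\to0$. (H4) If $(\xi_n)$ is a sequence in $\mathcal A$, $\xi\in\mathcal A$ and $d(\xi_n,\xi)\to0$, then there is a subsequence with $\widetilde d(\xi_{n_k},\xi)\to0$. A function $V:\mathrm{dom}(V)\to\mathbb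 N_0\cup\{\infty\}$ is given, where $\mathcal X\setminus\mathcal O\subseteq\mathrm{dom}(V)\subseteq\mathcal X$, with the following properties. (V1) If $\xi_n,\xi\in\mathcal X\setminus\mathcal O$ and $d(\xi_n,\xi)\to0$, then $V(\xi)\le\liminf_{n\to\infty}V(\xi_n)$. (V2) There is a set $\mathcal R\subseteq\widetilde{\mathcal X}\setminus\mathcal O$ such that if $\xi_n\in\widetilde{\mathcal X}\setminus\mathcal O$, $\xi\in\mathcal R$ and $\widetilde d(\xi_n,\xi)\to0$, then $V(\xi)=\lim_{n\to\infty}V(\xi_n)$. (V3) For all $t\in\mathbb T_+$ and $\xi\in\mathcal X\setminus\mathcal O$: $V(S(t,\xi))\le V(\xi)$. (V4) There is $T\in\mathbb T_+$ such that for any $t\in\mathbb T_+$ with $t\ge T$ and any $\xi\in\mathcal X\setminus\mathcal O$: if $V(S(t,\xi))=V(\xi)$, then $S(t,\xi)\in\mathcal R$. (V5) If $\mathcal O\ne\emptyset$, then there exist $N^*\in\mathbb N_0$ and an open neighborhood $U\subseteq\mathcal X$ of $\mathcal O$ such that for any entire solution $\varphi:\mathbb T\to\mathcal X\setminus\mathcal O$ of $S$: (a) if there is $t_0$ with $\varphi(t)\in\overline U\cap\mathcal A$ for all $t\le t_0$, then $V(\varphi(t))\le N^*$ for all $t\in\mathbb T$; (b) if there is $t_1$ with $\varphi(t)\in\overline U\cap\mathcal A$ for all $t\ge t_1$, then $V(\varphi(t))\ge N^*$ for all $t\in\mathbb T$. Sets. For $N\in\mathbb N_0$ (with $N\ne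 N^*$ if $\mathcal O\ne\emptyset$), $\mathcal S_N$ is the set of $\xi\in\mathcal A\setminus\mathcal O$ for which there is a bounded entire solution $\varphi$ through $\xi$ with $V(\varphi(t))=N$ for all $t\in\mathbb T$ and $(\alpha(\varphi)\cup\omega(\xi))\cap\mathcal O=\emptyset$. For fixed $N_0\in\mathbb N_0$ (with $N_0>N^*$ if $\mathcal O\ne\emptyset$), $\mathcal S_{N_0}^+$ is the set of $\xi\in\mathcal A\setminus\mathcal O$ for which there is a bounded entire solution $\varphi$ through $\xi$ with $V(\varphi(t))\ge N_0$ for all $t\in\mathbb T$ and $(\alpha(\varphi)\cup\omega(\xi))\cap\mathcal O=\emptyset$. If $\mathcal O\ne\emptyset$, $\mathcal S_{N^*}$ is the union of $\mathcal O$ and the set of $\xi\in\mathcal A\setminus\mathcal O$ for which there is a bounded entire solution $\varphi$ through $\xi$ with $V(\varphi(t))=N^*$ for all $t\in\mathbb T$. Finally, $\mathcal M_n:=\mathcal S_n$ for $0\le n<N_0$ and $\mathcal M_{N_0}:=\mathcal S_{N_0}^+$.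
   Formalization: Two assumptions are added, without which the claim fails as written: the global attractor 𝒜 is nonempty, and no point of 𝒜∖𝒪 enters 𝒪 in finite time (automatic from (V3) if dom V = 𝒳∖𝒪). *)

theory Defs
  imports "HOL-Analysis.Analysis"
begin

text \<open>
  Time is modelled inside the reals: \<open>\<T>\<close> is either \<open>UNIV\<close> or \<open>\<int>\<close>. Semi-dynamical systems and
  entire solutions are functions on all of \<open>real\<close>, but only their values at times in
  \<open>\<T>\<close> are ever constrained or used.
\<close>

definition nonneg_times :: "real set \<Rightarrow> real set" where
  "nonneg_times \<T> = \<T> \<inter> {0..}"

definition semi_dynamical_system ::
  "real set \<Rightarrow> (real \<Rightarrow> 'x::metric_space \<Rightarrow> 'x) \<Rightarrow> bool" where
  "semi_dynamical_system \<T> S \<longleftrightarrow>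
     continuous_on (nonneg_times \<T> \<times> UNIV) (\<lambda>(t, x). S t x) \<and>
     (\<forall>x. S 0 x = x) \<and>
     (\<forall>t\<in>nonneg_times \<T>. \<forall>s\<in>nonneg_times \<T>. \<forall>x. S (t + s) x = S t (S s x))"

definition invariant_set ::
  "real set \<Rightarrow> (real \<Rightarrow> 'x \<Rightarrow> 'x) \<Rightarrow> 'x set \<Rightarrow> bool" where
  "invariant_set \<T> S B \<longleftrightarrow> (\<forall>t\<in>nonneg_times \<T>. S t ` B = B)"

definition omega_limit_set ::
  "real set \<Rightarrow> (real \<Rightarrow> 'x::metric_space \<Rightarrow> 'x) \<Rightarrow> 'x set \<Rightarrow> 'x set" where
  "omega_limit_set \<T> S B =
     (\<Inter>t\<in>\<T>. closure (\<Union>s\<in>{s \<in> nonneg_times \<T>. t \<le> s}. S s ` B))"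

definition global_attractor ::
  "real set \<Rightarrow> (real \<Rightarrow> 'x::metric_space \<Rightarrow> 'x) \<Rightarrow> 'x set \<Rightarrow> bool" where
  "global_attractor \<T> S \<A> \<longleftrightarrow>
     compact \<A> \<and> invariant_set \<T> S \<A> \<and>
     (\<forall>B. bounded B \<longrightarrow> omega_limit_set \<T> S B \<subseteq> \<A>) \<and>
     (\<forall>C. compact C \<and> invariant_set \<T> S C \<and>
          (\<forall>B. bounded B \<longrightarrow> omega_limit_set \<T> S B \<subseteq> C) \<longrightarrow> C \<subseteq> \<A>)"

definition entire_solution ::
  "real set \<Rightarrow> (real \<Rightarrow> 'x \<Rightarrow> 'x) \<Rightarrow> (real \<Rightarrow> 'x) \<Rightarrow> bool" where
  "entire_solution \<T> S \<phi> \<longleftrightarrow> (\<forall>s\<in>\<T>. \<forall>t\<in>nonneg_times \<T>. \<phi> (s + t) = S t (\<phi> s))"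

definition bounded_entire_solution_through ::
  "real set \<Rightarrow> (real \<Rightarrow> 'x::metric_space \<Rightarrow> 'x) \<Rightarrow> 'x \<Rightarrow> (real \<Rightarrow> 'x) \<Rightarrow> bool" where
  "bounded_entire_solution_through \<T> S \<xi> \<phi> \<longleftrightarrow>
     entire_solution \<T> S \<phi> \<and> bounded (\<phi> ` \<T>) \<and> \<phi> 0 = \<xi>"

definition omega_limit ::
  "real set \<Rightarrow> (real \<Rightarrow> 'x::metric_space \<Rightarrow> 'x) \<Rightarrow> 'x \<Rightarrow> 'x set" where
  "omega_limit \<T> S \<xi> =
     {\<eta>. \<exists>\<tau>::nat \<Rightarrow> real. (\<forall>n. \<tau> n \<in> nonneg_times \<T>) \<and>
          filterlim \<tau> at_top sequentially \<and> (\<lambda>n. S (\<tau> n) \<xi>) \<longlonglongrightarrow> \<eta>}"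

definition alpha_limit ::
  "real set \<Rightarrow> (real \<Rightarrow> 'x::metric_space) \<Rightarrow> 'x set" where
  "alpha_limit \<T> \<phi> =
     {\<eta>. \<exists>\<tau>::nat \<Rightarrow> real. (\<forall>n. \<tau> n \<in> \<T>) \<and>
          filterlim \<tau> at_bot sequentially \<and> (\<lambda>n. \<phi> (\<tau> n)) \<longlonglongrightarrow> \<eta>}"

text \<open>
  A finite ordered collection of sets is a family \<open>M\<close> over a nonempty finite index set
  \<open>I\<close> of naturals, ordered by its indices. Indexing by a subset of the naturals, rather than
  by an initial segment, makes it possible to drop the empty members of a listed family
  without renumbering.
\<close>

definition morse_decomposition ::
  "real set \<Rightarrow> (real \<Rightarrow> 'x::metric_space \<Rightarrow> 'x) \<Rightarrow> 'x set \<Rightarrow> nat set \<Rightarrow> (nat \<Rightarrow> 'x set) \<Rightarrow> bool" where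
  "morse_decomposition \<T> S \<A> I M \<longleftrightarrow>
     finite I \<and> I \<noteq> {} \<and>
     (\<forall>n\<in>I. M n \<noteq> {} \<and> compact (M n) \<and> invariant_set \<T> S (M n) \<and> M n \<subseteq> \<A>) \<and>
     (\<forall>i\<in>I. \<forall>j\<in>I. i \<noteq> j \<longrightarrow> M i \<inter> M j = {}) \<and>
     (\<forall>\<xi>\<in>\<A>. \<forall>\<phi>. bounded_entire_solution_through \<T> S \<xi> \<phi> \<longrightarrow>
        (\<exists>N\<in>I. \<exists>K\<in>I. N \<le> K \<and> alpha_limit \<T> \<phi> \<subseteq> M K \<and> omega_limit \<T> S \<xi> \<subseteq> M N \<and>
           (N = K \<longrightarrow> (\<forall>t\<in>\<T>. \<phi> t \<in> M N))))"

text \<open>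
  Convention for a list \<open>M 0, \<dots>, M m\<close> with possibly empty members: the nonempty members,
  in the given order, form a Morse decomposition (so not all members are empty).
\<close>

definition listed_morse_decomposition ::
  "real set \<Rightarrow> (real \<Rightarrow> 'x::metric_space \<Rightarrow> 'x) \<Rightarrow> 'x set \<Rightarrow> nat \<Rightarrow> (nat \<Rightarrow> 'x set) \<Rightarrow> bool" where
  "listed_morse_decomposition \<T> S \<A> m M \<longleftrightarrow>
     morse_decomposition \<T> S \<A> {n \<in> {0..m}. M n \<noteq> {}} M"

text \<open>
  The partial function \<open>V\<close> is rendered by a total function together with its domain
  \<open>D\<close>; a condition on \<open>V (\<phi> t)\<close> includes \<open>\<phi> t \<in> D\<close>.
\<close>

definition level_set ::
  "real set \<Rightarrow> (real \<Rightarrow> 'x::metric_space \<Rightarrow> 'x) \<Rightarrow> 'x set \<Rightarrow> 'x set \<Rightarrow> 'x set \<Rightarrow> ('x \<Rightarrow> enat)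
    \<Rightarrow> nat \<Rightarrow> 'x set" where
  "level_set \<T> S \<A> \<O> D V N =
     {\<xi> \<in> \<A> - \<O>. \<exists>\<phi>. bounded_entire_solution_through \<T> S \<xi> \<phi> \<and>
        (\<forall>t\<in>\<T>. \<phi> t \<in> D \<and> V (\<phi> t) = enat N) \<and>
        (alpha_limit \<T> \<phi> \<union> omega_limit \<T> S \<xi>) \<inter> \<O> = {}}"

definition upper_level_set ::
  "real set \<Rightarrow> (real \<Rightarrow> 'x::metric_space \<Rightarrow> 'x) \<Rightarrow> 'x set \<Rightarrow> 'x set \<Rightarrow> 'x set \<Rightarrow> ('x \<Rightarrow> enat)
    \<Rightarrow> nat \<Rightarrow> 'x set" where
  "upper_level_set \<T> S \<A> \<O> D V N0 =
     {\<xi> \<in> \<A> - \<O>. \<exists>\<phi>. bounded_entire_solution_through \<T> S \<xi> \<phi> \<and>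
        (\<forall>t\<in>\<T>. \<phi> t \<in> D \<and> enat N0 \<le> V (\<phi> t)) \<and>
        (alpha_limit \<T> \<phi> \<union> omega_limit \<T> S \<xi>) \<inter> \<O> = {}}"

definition critical_level_set ::
  "real set \<Rightarrow> (real \<Rightarrow> 'x::metric_space \<Rightarrow> 'x) \<Rightarrow> 'x set \<Rightarrow> 'x set \<Rightarrow> 'x set \<Rightarrow> ('x \<Rightarrow> enat)
    \<Rightarrow> nat \<Rightarrow> 'x set" where
  "critical_level_set \<T> S \<A> \<O> D V Nstar =
     \<O> \<union> {\<xi> \<in> \<A> - \<O>. \<exists>\<phi>. bounded_entire_solution_through \<T> S \<xi> \<phi> \<and>
        (\<forall>t\<in>\<T>. \<phi> t \<in> D \<and> V (\<phi> t) = enat Nstar)}"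

text \<open>The number \<open>Nstar\<close> plays no role when \<open>\<O>\<close> is empty.\<close>

definition morse_set ::
  "real set \<Rightarrow> (real \<Rightarrow> 'x::metric_space \<Rightarrow> 'x) \<Rightarrow> 'x set \<Rightarrow> 'x set \<Rightarrow> 'x set \<Rightarrow> ('x \<Rightarrow> enat)
    \<Rightarrow> nat \<Rightarrow> nat \<Rightarrow> nat \<Rightarrow> 'x set" where
  "morse_set \<T> S \<A> \<O> D V Nstar N0 n =
     (if n < N0
      then (if \<O> \<noteq> {} \<and> n = Nstar
            then critical_level_set \<T> S \<A> \<O> D V Nstar
            else level_set \<T> S \<A> \<O> D V n)
      else upper_level_set \<T> S \<A> \<O> D V N0)"

end

theory Submission
  imports Defs
begin

text \<open>
  Along a solution in \<open>\<A> - \<O>\<close> the function \<open>V\<close> is nonincreasing, so it has a limit \<open>L\<close> in each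
  time direction, and every solution \<open>\<psi>\<close> in the corresponding limit set that avoids \<open>\<O>\<close> has
  \<open>V = L\<close> throughout: lower semicontinuity gives \<open>V \<le> L\<close>; conversely, as \<open>enat\<close> is well-ordered,
  \<open>V\<close> is eventually constant along \<open>\<psi>\<close>, so \<open>\<psi> t \<in> \<R>\<close> for large \<open>t\<close>, where \<open>V\<close> is continuous, and
  monotonicity carries \<open>V \<ge> L\<close> back to all earlier times.

  If a limit set meets \<open>\<O>\<close> while the solution keeps leaving \<open>U\<close>, then translating it to its first
  exit times after visits near \<open>\<O>\<close>, and to its last times outside \<open>U\<close> before such visits, yields
  limit solutions that stay in \<open>closure U\<close> for all negative, respectively all positive, times.
  Hypothesis (V5) then forces \<open>L = Nstar\<close>. The same passage argument, applied to a sequence of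
  solutions, separates the noncritical Morse sets from \<open>\<O>\<close> and hence makes them compact.
\<close>

section \<open>Entire solutions and limit sets\<close>

locale attracted_semiflow =
  fixes \<T> :: "real set"
    and S :: "real \<Rightarrow> 'x::metric_space \<Rightarrow> 'x"
    and \<A> :: "'x set"
  assumes time: "\<T> = UNIV \<or> \<T> = \<int>"
    and sds: "semi_dynamical_system \<T> S"
    and attractor: "global_attractor \<T> S \<A>"
begin

lemma times_closed: "closed \<T>"
  using time by auto

lemma times_zero [simp]: "0 \<in> \<T>"
  and times_one [simp]: "1 \<in> \<T>"
  and times_of_nat [simp]: "real n \<in> \<T>"
  and times_add [intro]: "s \<in> \<T> \<Longrightarrow> t \<in> \<T> \<Longrightarrow> s + t \<in> \<T>"
  and times_diff [intro]: "s \<in> \<T> \<Longrightarrow> t \<in> \<T> \<Longrightarrow> s - t \<in> \<T>"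
  and times_uminus [intro]: "s \<in> \<T> \<Longrightarrow> - s \<in> \<T>"
  using time by auto

lemma nonneg_times_iff: "t \<in> nonneg_times \<T> \<longleftrightarrow> t \<in> \<T> \<and> 0 \<le> t"
  by (auto simp: nonneg_times_def)

lemma compact_attractor: "compact \<A>"
  and invariant_attractor: "invariant_set \<T> S \<A>"
  using attractor by (auto simp: global_attractor_def)

lemma closed_attractor: "closed \<A>"
  using compact_attractor compact_imp_closed by blast

lemma S_zero [simp]: "S 0 x = x"
  using sds by (auto simp: semi_dynamical_system_def)

lemma S_add: "s \<in> \<T> \<Longrightarrow> 0 \<le> s \<Longrightarrow> t \<in> \<T> \<Longrightarrow> 0 \<le> t \<Longrightarrow> S (s + t) x = S s (S t x)"
  using sds by (auto simp: semi_dynamical_system_def nonneg_times_iff)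

lemma S_tendsto:
  assumes "\<And>n. s n \<in> \<T>" "\<And>n. 0 \<le> s n" "s \<longlonglongrightarrow> t" "x \<longlonglongrightarrow> y"
  shows "t \<in> \<T>" "0 \<le> t" "(\<lambda>n. S (s n) (x n)) \<longlonglongrightarrow> S t y"
proof -
  show t: "t \<in> \<T>"
    using times_closed assms closed_sequentially by blast
  show t0: "0 \<le> t"
    using assms LIMSEQ_le_const by blast
  have "continuous_on (nonneg_times \<T> \<times> UNIV) (\<lambda>p. S (fst p) (snd p))"
    using sds by (simp add: semi_dynamical_system_def case_prod_unfold)
  then have "(\<lambda>n. (\<lambda>p. S (fst p) (snd p)) (s n, x n)) \<longlonglongrightarrow> (\<lambda>p. S (fst p) (snd p)) (t, y)"
    by (rule continuous_on_tendsto_compose)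
      (use assms t t0 in \<open>auto intro: tendsto_Pair simp: nonneg_times_iff\<close>)
  then show "(\<lambda>n. S (s n) (x n)) \<longlonglongrightarrow> S t y"
    by simp
qed

lemma S_tendsto_const:
  assumes "t \<in> \<T>" "0 \<le> t" "x \<longlonglongrightarrow> y"
  shows "(\<lambda>n. S t (x n)) \<longlonglongrightarrow> S t y"
  using S_tendsto(3)[of "\<lambda>_. t" t x y] assms by auto

section \<open>Entire solutions inside the attractor\<close>

definition attractor_solution :: "(real \<Rightarrow> 'x) \<Rightarrow> bool" where
  "attractor_solution \<phi> \<longleftrightarrow> entire_solution \<T> S \<phi> \<and> (\<forall>t\<in>\<T>. \<phi> t \<in> \<A>)"

lemma attractor_solution_in: "attractor_solution \<phi> \<Longrightarrow> t \<in> \<T> \<Longrightarrow> \<phi> t \<in> \<A>"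
  by (simp add: attractor_solution_def)

lemma attractor_solution_step:
  "attractor_solution \<phi> \<Longrightarrow> s \<in> \<T> \<Longrightarrow> t \<in> \<T> \<Longrightarrow> s \<le> t \<Longrightarrow> \<phi> t = S (t - s) (\<phi> s)"
  using bspec[of "nonneg_times \<T>" "\<lambda>r. \<phi> (s + r) = S r (\<phi> s)" "t - s"]
  by (auto simp: attractor_solution_def entire_solution_def nonneg_times_iff)

lemma attractor_solution_shift:
  assumes "attractor_solution \<phi>" "a \<in> \<T>"
  shows "attractor_solution (\<lambda>t. \<phi> (a + t))"
  using assms times_add unfolding attractor_solution_def entire_solution_def
  by (auto simp flip: add.assoc)

text \<open>The range of a bounded entire solution is a bounded set, each of whose points is
  \<open>S s\<close> of a point of the range for arbitrarily large \<open>s\<close>. So it lies in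
  the omega-limit set of its own range and hence in \<open>\<A>\<close>. From here on, boundedness
  is used as containment in \<open>\<A>\<close>.\<close>

lemma bounded_entire_solution_through_iff:
  "bounded_entire_solution_through \<T> S \<xi> \<phi> \<longleftrightarrow> attractor_solution \<phi> \<and> \<phi> 0 = \<xi>"
proof
  assume b: "bounded_entire_solution_through \<T> S \<xi> \<phi>"
  then have e: "entire_solution \<T> S \<phi>" and bd: "bounded (\<phi> ` \<T>)"
    by (auto simp: bounded_entire_solution_through_def)
  have "\<phi> t \<in> omega_limit_set \<T> S (\<phi> ` \<T>)" if t: "t \<in> \<T>" for t
    unfolding omega_limit_set_def
  proof
    fix r assume r: "r \<in> \<T>"
    \<comment> \<open>The index \<open>r\<close> may be negative, while \<open>S\<close> is
      constrained at nonnegative times only.\<close>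
    define s where "s = max r 0"
    have s: "s \<in> \<T>" "0 \<le> s" "r \<le> s"
      using r by (auto simp: s_def max_def)
    have "\<phi> t = S s (\<phi> (t - s))"
      using e[unfolded entire_solution_def, rule_format, OF times_diff[OF t s(1)], of s] s
      by (simp add: nonneg_times_iff)
    then have "\<phi> t \<in> (\<Union>s\<in>{s \<in> nonneg_times \<T>. r \<le> s}. S s ` (\<phi> ` \<T>))"
      using s t times_diff[OF t s(1)] by (auto simp: nonneg_times_iff)
    then show "\<phi> t \<in> closure (\<Union>s\<in>{s \<in> nonneg_times \<T>. r \<le> s}. S s ` (\<phi> ` \<T>))"
      by (rule subsetD[OF closure_subset])
  qed
  then have "\<forall>t\<in>\<T>. \<phi> t \<in> \<A>"
    using attractor bd unfolding global_attractor_def by blast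
  with b show "attractor_solution \<phi> \<and> \<phi> 0 = \<xi>"
    by (auto simp: attractor_solution_def bounded_entire_solution_through_def)
next
  assume "attractor_solution \<phi> \<and> \<phi> 0 = \<xi>"
  moreover from this have "bounded (\<phi> ` \<T>)"
    by (intro bounded_subset[OF compact_imp_bounded[OF compact_attractor]])
      (auto simp: attractor_solution_def)
  ultimately show "bounded_entire_solution_through \<T> S \<xi> \<phi>"
    by (auto simp: attractor_solution_def bounded_entire_solution_through_def)
qed

section \<open>Compactness of the set of solutions\<close>

lemma compact_diagonal_subseq:
  fixes f :: "nat \<Rightarrow> nat \<Rightarrow> 'x"
  assumes "\<And>n k. f n k \<in> \<A>"
  obtains r g where "strict_mono r" "\<And>k. (\<lambda>n. f (r n) k) \<longlonglongrightarrow> g k"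
proof -
  \<comment> \<open>Tychonoff's theorem replaces a diagonal argument: a countable power of
    \<open>\<A>\<close> is compact, and a countable product of metric spaces is first countable, so
    compactness yields a convergent subsequence.\<close>
  have "compactin (product_topology (\<lambda>_. euclidean) UNIV) (PiE UNIV (\<lambda>_::nat. \<A>))"
    unfolding compactin_PiE using compact_attractor by simp
  then have "compact (PiE UNIV (\<lambda>_::nat. \<A>))"
    by (simp add: euclidean_product_topology)
  moreover have "\<forall>n. f n \<in> PiE UNIV (\<lambda>_. \<A>)"
    using assms by auto
  ultimately obtain g r where "strict_mono r" "(f \<circ> r) \<longlonglongrightarrow> g"
    using compact_imp_seq_compact seq_compactE by metis
  moreover have "(\<lambda>n. (f \<circ> r) n k) \<longlonglongrightarrow> g k" for k
    using continuous_on_tendsto_compose[OF continuous_on_product_coordinates \<open>(f \<circ> r) \<longlonglongrightarrow> g\<close>]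
    by auto
  ultimately show thesis
    using that[of r g] by (simp add: o_def)
qed

text \<open>The functions \<open>\<phi> n\<close> need to be solutions only on \<open>[-n, \<infinity>)\<close>, so that the lemma also
  yields entire solutions through given points of the attractor.\<close>

lemma solution_limit:
  assumes in_A: "\<And>n t. t \<in> \<T> \<Longrightarrow> - real n \<le> t \<Longrightarrow> \<phi> n t \<in> \<A>"
    and step: "\<And>n s t. s \<in> \<T> \<Longrightarrow> t \<in> \<T> \<Longrightarrow> - real n \<le> s \<Longrightarrow> s \<le> t \<Longrightarrow> \<phi> n t = S (t - s) (\<phi> n s)"
  obtains r \<psi> where "strict_mono r" "attractor_solution \<psi>"
    "\<And>t. t \<in> \<T> \<Longrightarrow> (\<lambda>n. \<phi> (r n) t) \<longlonglongrightarrow> \<psi> t"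
proof -
  \<comment> \<open>The values at the times \<open>- k\<close> determine a solution at all later
    times, so convergence of this countable family suffices. The minimum keeps the sampling time in
    the range where \<open>\<phi> n\<close> is known to stay in \<open>\<A>\<close>; it equals
    \<open>k\<close> once \<open>n \<ge> k\<close>.\<close>
  define f where "f n k = \<phi> n (- real (min k n))" for n k
  have "f n k \<in> \<A>" for n k
    unfolding f_def using times_uminus[OF times_of_nat] by (intro in_A) auto
  then obtain r g where r: "strict_mono r" and g: "\<And>k. (\<lambda>n. f (r n) k) \<longlonglongrightarrow> g k"
    using compact_diagonal_subseq by metis
  have far: "\<forall>\<^sub>F n in sequentially. k \<le> r n" for k
    using filterlim_subseq[OF r] by (simp add: filterlim_at_top)
  have lim: "(\<lambda>n. \<phi> (r n) t) \<longlonglongrightarrow> S (t + real k) (g k)" if t: "t \<in> \<T>" "- real k \<le> t" for t k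
  proof -
    have "(\<lambda>n. S (t + real k) (f (r n) k)) \<longlonglongrightarrow> S (t + real k) (g k)"
      using t g by (intro S_tendsto_const) auto
    moreover have "\<forall>\<^sub>F n in sequentially. S (t + real k) (f (r n) k) = \<phi> (r n) t"
      using far[of k]
    proof eventually_elim
      case (elim n)
      then have "\<phi> (r n) t = S (t - (- real k)) (\<phi> (r n) (- real k))"
        using t times_uminus[OF times_of_nat] by (intro step) auto
      with elim show ?case
        by (simp add: f_def)
    qed
    ultimately show ?thesis
      by (rule Lim_transform_eventually)
  qed
  \<comment> \<open>Any index \<open>k\<close> with \<open>- k \<le> t\<close> would serve: by
    \<open>lim\<close> all of them give the same limit at time \<open>t\<close>.\<close>
  define K where "K t = nat \<lceil>- t\<rceil>" for t :: real
  have K: "- real (K t) \<le> t" for t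
    unfolding K_def by linarith
  define \<psi> where "\<psi> t = S (t + real (K t)) (g (K t))" for t
  have psi: "(\<lambda>n. \<phi> (r n) t) \<longlonglongrightarrow> \<psi> t" if "t \<in> \<T>" for t
    unfolding \<psi>_def using lim[OF that K] .
  have "\<psi> t \<in> \<A>" if t: "t \<in> \<T>" for t
  proof -
    have "\<forall>\<^sub>F n in sequentially. \<phi> (r n) t \<in> \<A>"
      using far[of "K t"]
    proof eventually_elim
      case (elim n)
      then show ?case
        using t K[of t] by (intro in_A) auto
    qed
    then show ?thesis
      by (rule Lim_in_closed_set[OF closed_attractor _ sequentially_bot psi[OF t]])
  qed
  moreover have "\<psi> (s + t) = S t (\<psi> s)" if s: "s \<in> \<T>" and t: "t \<in> \<T>" "0 \<le> t" for s t
  proof -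
    have "(\<lambda>n. S t (\<phi> (r n) s)) \<longlonglongrightarrow> S t (\<psi> s)"
      using t psi[OF s] by (rule S_tendsto_const)
    moreover have "\<forall>\<^sub>F n in sequentially. S t (\<phi> (r n) s) = \<phi> (r n) (s + t)"
      using far[of "K s"]
    proof eventually_elim
      case (elim n)
      then have "\<phi> (r n) (s + t) = S (s + t - s) (\<phi> (r n) s)"
        using s t K[of s] by (intro step) auto
      then show ?case
        by simp
    qed
    ultimately have "(\<lambda>n. \<phi> (r n) (s + t)) \<longlonglongrightarrow> S t (\<psi> s)"
      by (rule Lim_transform_eventually)
    then show ?thesis
      using psi[OF times_add[OF s t(1)]] LIMSEQ_unique by blast
  qed
  ultimately have "attractor_solution \<psi>"
    by (simp add: attractor_solution_def entire_solution_def nonneg_times_iff)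
  with r psi show thesis
    using that by blast
qed

lemma attractor_solution_limit:
  fixes \<phi> :: "nat \<Rightarrow> real \<Rightarrow> 'x"
  assumes "\<And>n. attractor_solution (\<phi> n)"
  obtains r \<psi> where "strict_mono r" "attractor_solution \<psi>"
    "\<And>t. t \<in> \<T> \<Longrightarrow> (\<lambda>n. \<phi> (r n) t) \<longlonglongrightarrow> \<psi> t"
  using solution_limit[of \<phi>] that attractor_solution_in[OF assms] attractor_solution_step[OF assms]
  by metis

text \<open>Invariance provides points \<open>y n\<close> that reach \<open>\<xi>\<close> after time
  \<open>n\<close>. Started at time \<open>- n\<close>, their orbits all pass through
  \<open>\<xi>\<close> at time 0, and a limit of them is defined for all times.\<close>

lemma attractor_solution_exists:
  assumes "\<xi> \<in> \<A>"
  obtains \<phi> where "attractor_solution \<phi>" "\<phi> 0 = \<xi>"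
proof -
  have "S (real n) ` \<A> = \<A>" for n
    using invariant_attractor by (simp add: invariant_set_def nonneg_times_iff)
  then have "\<exists>y. y \<in> \<A> \<and> S (real n) y = \<xi>" for n
    using assms by (metis imageE)
  then obtain y where y: "\<And>n. y n \<in> \<A>" "\<And>n. S (real n) (y n) = \<xi>"
    by metis
  define f where "f n t = S (t + real n) (y n)" for n t
  have "f n t \<in> \<A>" if "t \<in> \<T>" "- real n \<le> t" for n t
    unfolding f_def using that y invariant_attractor nonneg_times_iff[of "t + real n"]
    by (force simp: invariant_set_def)
  moreover have "f n t = S (t - s) (f n s)"
    if "s \<in> \<T>" "t \<in> \<T>" "- real n \<le> s" "s \<le> t" for n s t
    unfolding f_def
    using that S_add[of "t - s" "s + real n" "y n"] times_add[OF that(1) times_of_nat[of n]]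
    by (auto simp: algebra_simps)
  ultimately obtain r \<psi> where \<psi>: "attractor_solution \<psi>" "\<And>t. t \<in> \<T> \<Longrightarrow> (\<lambda>n. f (r n) t) \<longlonglongrightarrow> \<psi> t"
    using solution_limit[of f] by metis
  have "\<psi> 0 = \<xi>"
    using y(2) \<psi>(2)[OF times_zero] by (simp add: f_def LIMSEQ_const_iff)
  with \<psi> that show thesis
    by blast
qed

section \<open>Limit sets in both directions of time\<close>

text \<open>The sign \<open>\<sigma> = \<plusminus>1\<close> selects the direction of time: the omega-limit set for \<open>\<sigma> = 1\<close> and
  the alpha-limit set for \<open>\<sigma> = -1\<close>.\<close>

definition limit_set :: "real \<Rightarrow> (real \<Rightarrow> 'x) \<Rightarrow> 'x set" where
  "limit_set \<sigma> \<phi> = {\<eta>. \<exists>\<tau>. (\<forall>n. \<tau> n \<in> \<T>) \<and>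
     filterlim (\<lambda>n. \<sigma> * \<tau> n) at_top sequentially \<and> (\<lambda>n. \<phi> (\<tau> n)) \<longlonglongrightarrow> \<eta>}"

lemma alpha_limit_eq: "alpha_limit \<T> \<phi> = limit_set (-1) \<phi>"
  by (auto simp: alpha_limit_def limit_set_def filterlim_uminus_at_bot)

lemma omega_limit_eq:
  assumes "attractor_solution \<phi>"
  shows "omega_limit \<T> S (\<phi> 0) = limit_set 1 \<phi>"
proof -
  have eq: "S t (\<phi> 0) = \<phi> t" if "t \<in> \<T>" "0 \<le> t" for t
    using attractor_solution_step[OF assms times_zero that] by simp
  show ?thesis
  proof (intro equalityI subsetI)
    fix \<eta> assume "\<eta> \<in> omega_limit \<T> S (\<phi> 0)"
    then show "\<eta> \<in> limit_set 1 \<phi>"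
      using eq by (auto simp: omega_limit_def limit_set_def nonneg_times_iff)
  next
    fix \<eta> assume "\<eta> \<in> limit_set 1 \<phi>"
    then obtain \<tau> where \<tau>: "\<And>n. \<tau> n \<in> \<T>" "filterlim \<tau> at_top sequentially" "(\<lambda>n. \<phi> (\<tau> n)) \<longlonglongrightarrow> \<eta>"
      by (auto simp: limit_set_def)
    \<comment> \<open>\<open>omega_limit\<close> requires every time of the sequence to be
      nonnegative, so an initial segment is dropped.\<close>
    obtain N where N: "\<And>n. n \<ge> N \<Longrightarrow> 0 \<le> \<tau> n"
      using \<tau>(2) unfolding filterlim_at_top eventually_sequentially by metis
    show "\<eta> \<in> omega_limit \<T> S (\<phi> 0)"
      unfolding omega_limit_def
      using \<tau> N eq filterlim_compose[OF \<tau>(2) filterlim_add_const_nat_at_top[of N]]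
        LIMSEQ_ignore_initial_segment[OF \<tau>(3), of N]
      by (auto simp: nonneg_times_iff intro!: exI[of _ "\<lambda>n. \<tau> (n + N)"])
  qed
qed

text \<open>The property may depend on the bound \<open>c\<close>, so that one parameter controls
  both how far out a time lies and how sharp an estimate holds there;
  \<open>closed_limit_set\<close> relies on this.\<close>

lemma unbounded_times_sequence:
  assumes "\<And>c. \<exists>t\<in>\<T>. c \<le> \<sigma> * t \<and> P c t"
  obtains \<tau> where "\<And>n. \<tau> n \<in> \<T>" "filterlim (\<lambda>n. \<sigma> * \<tau> n) at_top sequentially" "\<And>n. P (real n) (\<tau> n)"
proof -
  have "\<forall>n. \<exists>t. t \<in> \<T> \<and> real n \<le> \<sigma> * t \<and> P (real n) t"
    using assms by blast
  then obtain \<tau> where \<tau>: "\<And>n. \<tau> n \<in> \<T>" "\<And>n. real n \<le> \<sigma> * \<tau> n" "\<And>n. P (real n) (\<tau> n)"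
    using choice[of "\<lambda>n t. t \<in> \<T> \<and> real n \<le> \<sigma> * t \<and> P (real n) t"] by blast
  have "filterlim (\<lambda>n. \<sigma> * \<tau> n) at_top sequentially"
    using filterlim_at_top_mono[OF filterlim_real_sequentially] \<tau>(2) by auto
  with \<tau> that show thesis
    by blast
qed

lemma far_shift:
  fixes \<tau> :: "nat \<Rightarrow> real"
  assumes "filterlim (\<lambda>n. \<sigma> * \<tau> n) at_top sequentially"
  shows "filterlim (\<lambda>n. \<sigma> * (\<tau> n + t)) at_top sequentially"
proof -
  have "filterlim (\<lambda>n. \<sigma> * t + \<sigma> * \<tau> n) at_top sequentially"
    using assms by (rule filterlim_tendsto_add_at_top[OF tendsto_const])
  then show ?thesis
    by (simp add: algebra_simps)
qed

lemma far_between: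
  fixes a b e :: "nat \<Rightarrow> real"
  assumes "\<sigma> \<in> {1, -1}" "filterlim (\<lambda>n. \<sigma> * a n) at_top sequentially"
    "filterlim (\<lambda>n. \<sigma> * b n) at_top sequentially" "\<And>n. a n \<le> e n" "\<And>n. e n \<le> b n"
  shows "filterlim (\<lambda>n. \<sigma> * e n) at_top sequentially"
  using assms(1)
proof (elim insertE emptyE)
  assume "\<sigma> = 1"
  then show ?thesis
    using assms by (intro filterlim_at_top_mono[OF assms(2)]) auto
next
  assume "\<sigma> = -1"
  then show ?thesis
    using assms by (intro filterlim_at_top_mono[OF assms(3)]) auto
qed

text \<open>Pairs visits to one place with visits to another in a prescribed order. The sequence
  re-indexed outwards is \<open>b\<close> for \<open>\<sigma> = 1\<close> and \<open>a\<close> for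
  \<open>\<sigma> = -1\<close>, since in reversed time the further member is the smaller
  one.\<close>

lemma interlace:
  fixes a b :: "nat \<Rightarrow> real"
  assumes "\<sigma> \<in> {1, -1}" "filterlim (\<lambda>n. \<sigma> * a n) at_top sequentially"
    "filterlim (\<lambda>n. \<sigma> * b n) at_top sequentially"
  obtains k m :: "nat \<Rightarrow> nat" where "filterlim k sequentially sequentially"
    "filterlim m sequentially sequentially" "\<And>n. a (k n) \<le> b (m n)"
proof -
  have later: "\<exists>j. \<forall>n. n \<le> j n \<and> c n \<le> \<sigma> * d (j n)"
    if d: "filterlim (\<lambda>n. \<sigma> * d n) at_top sequentially" for c d :: "nat \<Rightarrow> real"
  proof (rule choice, rule allI)
    fix n
    have "\<forall>\<^sub>F j in sequentially. n \<le> j \<and> c n \<le> \<sigma> * d j"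
      using d eventually_ge_at_top[of n] by (auto simp: filterlim_at_top eventually_conj_iff)
    then show "\<exists>j\<ge>n. c n \<le> \<sigma> * d j"
      by (auto simp: eventually_sequentially)
  qed
  have j: "filterlim j sequentially sequentially" if "\<forall>n. n \<le> j n" for j :: "nat \<Rightarrow> nat"
    using that by (intro filterlim_at_top_mono[OF filterlim_ident] always_eventually)
  from assms(1) show thesis
  proof (elim insertE emptyE)
    assume s: "\<sigma> = 1"
    obtain m where "\<forall>n. n \<le> m n \<and> a n \<le> \<sigma> * b (m n)"
      using later[OF assms(3)] by blast
    then show thesis
      using that[of "\<lambda>n. n" m] j[of m] s filterlim_ident by auto
  next
    assume s: "\<sigma> = -1"
    obtain k where "\<forall>n. n \<le> k n \<and> - b n \<le> \<sigma> * a (k n)"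
      using later[OF assms(2), of "\<lambda>n. - b n"] by blast
    then show thesis
      using that[of k "\<lambda>n. n"] j[of k] s filterlim_ident by auto
  qed
qed

text \<open>Translates of a solution are solutions, so by compactness a subsequence of them
  converges at every time. The values of the limit are limit points of \<open>\<phi>\<close>,
  because adding a fixed \<open>t\<close> does not stop the times from running off to the
  end.\<close>

lemma limit_set_subseq:
  assumes "attractor_solution \<phi>" "\<And>n. \<tau> n \<in> \<T>" "filterlim (\<lambda>n. \<sigma> * \<tau> n) at_top sequentially"
  obtains r \<psi> where "strict_mono r" "attractor_solution \<psi>"
    "\<And>t. t \<in> \<T> \<Longrightarrow> (\<lambda>n. \<phi> (\<tau> (r n) + t)) \<longlonglongrightarrow> \<psi> t"
    "\<And>t. t \<in> \<T> \<Longrightarrow> filterlim (\<lambda>n. \<sigma> * (\<tau> (r n) + t)) at_top sequentially"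
    "\<And>t. t \<in> \<T> \<Longrightarrow> \<psi> t \<in> limit_set \<sigma> \<phi>"
proof -
  have "attractor_solution (\<lambda>t. \<phi> (\<tau> n + t))" for n
    using attractor_solution_shift assms by blast
  then obtain r \<psi> where r: "strict_mono r" "attractor_solution \<psi>"
      "\<And>t. t \<in> \<T> \<Longrightarrow> (\<lambda>n. \<phi> (\<tau> (r n) + t)) \<longlonglongrightarrow> \<psi> t"
    using attractor_solution_limit[of "\<lambda>n t. \<phi> (\<tau> n + t)"] by metis
  have far: "filterlim (\<lambda>n. \<sigma> * (\<tau> (r n) + t)) at_top sequentially" for t
    using filterlim_compose[OF assms(3) filterlim_subseq[OF r(1)]] by (rule far_shift)
  have "\<psi> t \<in> limit_set \<sigma> \<phi>" if t: "t \<in> \<T>" for t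
    using assms(2) r(3)[OF t] far[of t] t
    by (auto simp: limit_set_def intro!: exI[of _ "\<lambda>n. \<tau> (r n) + t"])
  with r far that show thesis
    by blast
qed

lemma limit_set_subset:
  assumes "closed C" "\<And>t. t \<in> \<T> \<Longrightarrow> a \<le> \<sigma> * t \<Longrightarrow> \<phi> t \<in> C"
  shows "limit_set \<sigma> \<phi> \<subseteq> C"
proof
  fix \<eta> assume "\<eta> \<in> limit_set \<sigma> \<phi>"
  then obtain \<tau> where \<tau>: "\<And>n. \<tau> n \<in> \<T>" "filterlim (\<lambda>n. \<sigma> * \<tau> n) at_top sequentially" "(\<lambda>n. \<phi> (\<tau> n)) \<longlonglongrightarrow> \<eta>"
    by (auto simp: limit_set_def)
  have "\<forall>\<^sub>F n in sequentially. a \<le> \<sigma> * \<tau> n"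
    using \<tau>(2) by (simp add: filterlim_at_top)
  then have "\<forall>\<^sub>F n in sequentially. \<phi> (\<tau> n) \<in> C"
    by eventually_elim (use assms \<tau> in auto)
  then show "\<eta> \<in> C"
    using Lim_in_closed_set[OF assms(1) _ sequentially_bot \<tau>(3)] by blast
qed

lemma limit_set_shift:
  assumes "a \<in> \<T>"
  shows "limit_set \<sigma> (\<lambda>t. \<phi> (a + t)) = limit_set \<sigma> \<phi>"
proof -
  have *: "limit_set \<sigma> (\<lambda>t. \<phi> (a + t)) \<subseteq> limit_set \<sigma> \<phi>" if a: "a \<in> \<T>" for a \<phi>
  proof
    fix \<eta> assume "\<eta> \<in> limit_set \<sigma> (\<lambda>t. \<phi> (a + t))"
    then obtain \<tau> where \<tau>: "\<And>n. \<tau> n \<in> \<T>" "filterlim (\<lambda>n. \<sigma> * \<tau> n) at_top sequentially"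
        "(\<lambda>n. \<phi> (a + \<tau> n)) \<longlonglongrightarrow> \<eta>"
      by (auto simp: limit_set_def)
    have "filterlim (\<lambda>n. \<sigma> * (a + \<tau> n)) at_top sequentially"
      using far_shift[OF \<tau>(2), of a] by (simp add: add.commute)
    with \<tau> a show "\<eta> \<in> limit_set \<sigma> \<phi>"
      by (auto simp: limit_set_def intro!: exI[of _ "\<lambda>n. a + \<tau> n"])
  qed
  \<comment> \<open>The reverse inclusion is the same one, for the shifted function and the shift
    \<open>- a\<close>.\<close>
  show ?thesis
    using *[OF assms] *[OF times_uminus[OF assms], of "\<lambda>t. \<phi> (a + t)"] by auto
qed

lemma times_unbounded:
  assumes "\<sigma> \<in> {1, -1}"
  shows "\<exists>t\<in>\<T>. c \<le> \<sigma> * t"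
proof -
  obtain n :: nat where "c \<le> real n"
    using real_arch_simple by blast
  then show ?thesis
    using assms times_uminus[OF times_of_nat, of n] times_of_nat[of n] by force
qed

lemma limit_set_nonempty:
  assumes "attractor_solution \<phi>" "\<sigma> \<in> {1, -1}"
  shows "limit_set \<sigma> \<phi> \<noteq> {}"
proof -
  obtain \<tau> where "\<And>n. \<tau> n \<in> \<T>" "filterlim (\<lambda>n. \<sigma> * \<tau> n) at_top sequentially"
    using unbounded_times_sequence[of \<sigma> "\<lambda>_ _. True"] times_unbounded[OF assms(2)] by metis
  then obtain \<psi> where "\<And>t. t \<in> \<T> \<Longrightarrow> \<psi> t \<in> limit_set \<sigma> \<phi>"
    using limit_set_subseq[OF assms(1)] by metis
  then show ?thesis
    using times_zero by blast
qed

lemma closed_limit_set: "closed (limit_set \<sigma> \<phi>)"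
proof -
  have "\<eta> \<in> limit_set \<sigma> \<phi>" if \<eta>: "\<eta> \<in> closure (limit_set \<sigma> \<phi>)" for \<eta>
  proof -
    have "\<exists>t\<in>\<T>. c \<le> \<sigma> * t \<and> dist (\<phi> t) \<eta> < inverse (1 + \<bar>c\<bar>)" for c
    proof -
      have "0 < inverse (1 + \<bar>c\<bar>) / 2"
        by (simp add: add_pos_nonneg)
      then obtain \<eta>' where "\<eta>' \<in> limit_set \<sigma> \<phi>" and d: "dist \<eta>' \<eta> < inverse (1 + \<bar>c\<bar>) / 2"
        using \<eta> closure_approachable by blast
      then obtain \<tau> where \<tau>: "\<And>n. \<tau> n \<in> \<T>" "filterlim (\<lambda>n. \<sigma> * \<tau> n) at_top sequentially"
          "(\<lambda>n. \<phi> (\<tau> n)) \<longlonglongrightarrow> \<eta>'"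
        by (auto simp: limit_set_def)
      have "\<forall>\<^sub>F n in sequentially. dist (\<phi> (\<tau> n)) \<eta>' < inverse (1 + \<bar>c\<bar>) / 2"
        using tendstoD[OF \<tau>(3) \<open>0 < inverse (1 + \<bar>c\<bar>) / 2\<close>] .
      moreover have "\<forall>\<^sub>F n in sequentially. c \<le> \<sigma> * \<tau> n"
        using \<tau>(2) by (simp add: filterlim_at_top)
      ultimately have "\<forall>\<^sub>F n in sequentially. dist (\<phi> (\<tau> n)) \<eta>' < inverse (1 + \<bar>c\<bar>) / 2 \<and> c \<le> \<sigma> * \<tau> n"
        by eventually_elim auto
      then obtain n where "dist (\<phi> (\<tau> n)) \<eta>' < inverse (1 + \<bar>c\<bar>) / 2" "c \<le> \<sigma> * \<tau> n"
        by (auto simp: eventually_sequentially)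
      then show ?thesis
        using d \<tau>(1) dist_triangle_half_r[of \<eta>' "\<phi> (\<tau> n)" "inverse (1 + \<bar>c\<bar>)" \<eta>]
        by (auto simp: dist_commute)
    qed
    then obtain \<tau> where \<tau>: "\<And>n. \<tau> n \<in> \<T>" "filterlim (\<lambda>n. \<sigma> * \<tau> n) at_top sequentially"
        "\<And>n. dist (\<phi> (\<tau> n)) \<eta> < inverse (1 + \<bar>real n\<bar>)"
      using unbounded_times_sequence[of \<sigma> "\<lambda>c t. dist (\<phi> t) \<eta> < inverse (1 + \<bar>c\<bar>)"] by metis
    have "(\<lambda>n. dist (\<phi> (\<tau> n)) \<eta>) \<longlonglongrightarrow> 0"
    proof (rule tendsto_sandwich[OF _ _ tendsto_const LIMSEQ_inverse_real_of_nat])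
      show "\<forall>\<^sub>F n in sequentially. dist (\<phi> (\<tau> n)) \<eta> \<le> inverse (real (Suc n))"
        using \<tau>(3) by (intro always_eventually) (auto simp: less_imp_le)
    qed auto
    then show ?thesis
      using \<tau> tendsto_dist_iff unfolding limit_set_def by blast
  qed
  then show ?thesis
    using closure_subset_eq by blast
qed

text \<open>Beyond the invariance of limit sets this records the times \<open>\<tau>\<close> whose
  translates produce \<open>\<psi>\<close>; they link the values of a Lyapunov function along
  \<open>\<psi>\<close> to those along \<open>\<phi>\<close>.\<close>

lemma limit_set_solution:
  assumes "attractor_solution \<phi>" "\<eta> \<in> limit_set \<sigma> \<phi>"
  obtains \<tau> \<psi> where "attractor_solution \<psi>" "\<psi> 0 = \<eta>" "\<And>n. \<tau> n \<in> \<T>"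
    "\<And>t. t \<in> \<T> \<Longrightarrow> (\<lambda>n. \<phi> (\<tau> n + t)) \<longlonglongrightarrow> \<psi> t"
    "\<And>t. t \<in> \<T> \<Longrightarrow> filterlim (\<lambda>n. \<sigma> * (\<tau> n + t)) at_top sequentially"
    "\<And>t. t \<in> \<T> \<Longrightarrow> \<psi> t \<in> limit_set \<sigma> \<phi>"
proof -
  obtain \<tau> where \<tau>: "\<And>n. \<tau> n \<in> \<T>" "filterlim (\<lambda>n. \<sigma> * \<tau> n) at_top sequentially" "(\<lambda>n. \<phi> (\<tau> n)) \<longlonglongrightarrow> \<eta>"
    using assms(2) by (auto simp: limit_set_def)
  obtain r \<psi> where r: "strict_mono r" "attractor_solution \<psi>"
    "\<And>t. t \<in> \<T> \<Longrightarrow> (\<lambda>n. \<phi> (\<tau> (r n) + t)) \<longlonglongrightarrow> \<psi> t"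
    "\<And>t. t \<in> \<T> \<Longrightarrow> filterlim (\<lambda>n. \<sigma> * (\<tau> (r n) + t)) at_top sequentially"
    "\<And>t. t \<in> \<T> \<Longrightarrow> \<psi> t \<in> limit_set \<sigma> \<phi>"
    using limit_set_subseq[OF assms(1) \<tau>(1,2)] by metis
  have "\<psi> 0 = \<eta>"
    using LIMSEQ_unique[OF _ LIMSEQ_subseq_LIMSEQ[OF \<tau>(3) r(1)]] r(3)[OF times_zero]
    by (simp add: o_def)
  with r \<tau> that[of \<psi> "\<tau> \<circ> r"] show thesis
    by simp
qed

section \<open>Passage times through a neighbourhood\<close>

text \<open>This is what makes the passage times near an invariant set tend to infinity.\<close>

lemma limit_step:
  fixes \<phi> :: "nat \<Rightarrow> real \<Rightarrow> 'x"
  assumes "\<And>n. attractor_solution (\<phi> n)" "\<And>n. u n \<in> \<T>" "\<And>n. v n \<in> \<T>"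
    and "(\<lambda>n. \<phi> n (u n)) \<longlonglongrightarrow> x" "(\<lambda>n. \<phi> n (v n)) \<longlonglongrightarrow> y"
    and lag: "\<forall>\<^sub>F n in sequentially. u n \<le> v n \<and> v n \<le> u n + c"
  shows "\<exists>\<delta>\<in>nonneg_times \<T>. y = S \<delta> x"
proof -
  obtain N where N: "\<And>n. n \<ge> N \<Longrightarrow> u n \<le> v n \<and> v n \<le> u n + c"
    using lag by (auto simp: eventually_sequentially)
  \<comment> \<open>The lags, taken past \<open>N\<close>, lie in the compact interval
    \<open>{0..c}\<close>. A subsequence converges to some \<open>\<delta>\<close>, and joint
    continuity of \<open>S\<close> in time and state identifies the limit.\<close>
  define w where "w n = v (n + N) - u (n + N)" for n
  have w: "w n \<in> \<T>" "w n \<in> {0..c}" for n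
    using N[of "n + N"] assms(2,3) by (auto simp: w_def)
  then obtain \<delta> r where r: "strict_mono r" "(w \<circ> r) \<longlonglongrightarrow> \<delta>"
    using compact_Icc[of 0 c] compact_imp_seq_compact seq_compactE by metis
  let ?i = "\<lambda>n. r n + N"
  have i: "filterlim ?i sequentially sequentially"
    using filterlim_compose[OF filterlim_add_const_nat_at_top[of N] filterlim_subseq[OF r(1)]] .
  have x: "(\<lambda>n. \<phi> (?i n) (u (?i n))) \<longlonglongrightarrow> x" and y: "(\<lambda>n. \<phi> (?i n) (v (?i n))) \<longlonglongrightarrow> y"
    using filterlim_compose[OF assms(4) i] filterlim_compose[OF assms(5) i] by auto
  have *: "\<delta> \<in> \<T>" "0 \<le> \<delta>" "(\<lambda>n. S ((w \<circ> r) n) (\<phi> (?i n) (u (?i n)))) \<longlonglongrightarrow> S \<delta> x"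
    using S_tendsto[of "w \<circ> r", OF _ _ r(2) x] w by auto
  have "S ((w \<circ> r) n) (\<phi> (?i n) (u (?i n))) = \<phi> (?i n) (v (?i n))" for n
    using attractor_solution_step[OF assms(1,2,3), of "?i n" "?i n" "?i n"] N[of "?i n"]
    by (simp add: w_def)
  with * y have "y = S \<delta> x"
    using LIMSEQ_unique by auto
  with * show ?thesis
    by (auto simp: nonneg_times_iff)
qed

text \<open>Compactness makes the first and the last time outside \<open>U\<close> exist, for real
  and integer time alike. Continuity of \<open>\<phi>\<close> on the interval is not part of being a
  solution; it follows from \<open>\<phi> t = S (t - a) (\<phi> a)\<close>.\<close>

lemma compact_outside_times:
  assumes "attractor_solution \<phi>" "open U" "a \<in> \<T>"
  shows "compact {t \<in> \<T>. t \<in> {a..b} \<and> \<phi> t \<notin> U}"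
proof -
  have "continuous_on (\<T> \<inter> {a..b}) \<phi>"
    unfolding continuous_on_sequentially
  proof (intro ballI allI impI)
    fix x t assume t: "t \<in> \<T> \<inter> {a..b}" and x: "(\<forall>n. x n \<in> \<T> \<inter> {a..b}) \<and> x \<longlonglongrightarrow> t"
    have "(\<lambda>n. S (x n - a) (\<phi> a)) \<longlonglongrightarrow> S (t - a) (\<phi> a)"
      using x assms(3) by (intro S_tendsto(3) tendsto_diff tendsto_const) auto
    moreover have "S (r - a) (\<phi> a) = \<phi> r" if "r \<in> \<T> \<inter> {a..b}" for r
      using attractor_solution_step[OF assms(1,3)] that by auto
    ultimately show "(\<phi> \<circ> x) \<longlonglongrightarrow> \<phi> t"
      using t x by (simp add: o_def)
  qed
  moreover have "closed (\<T> \<inter> {a..b})"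
    using times_closed by auto
  ultimately have "closed (\<phi> -` (- U) \<inter> (\<T> \<inter> {a..b}))"
    using assms(2) continuous_on_closed_vimage by blast
  moreover have "\<phi> -` (- U) \<inter> (\<T> \<inter> {a..b}) = {t \<in> \<T>. t \<in> {a..b} \<and> \<phi> t \<notin> U}"
    by auto
  ultimately have "closed {t \<in> \<T>. t \<in> {a..b} \<and> \<phi> t \<notin> U}"
    by simp
  moreover have "bounded {t \<in> \<T>. t \<in> {a..b} \<and> \<phi> t \<notin> U}"
    by (rule bounded_subset[of "{a..b}"]) auto
  ultimately show ?thesis
    by (simp add: compact_eq_bounded_closed)
qed

lemma first_exit:
  assumes "attractor_solution \<phi>" "open U" "a \<in> \<T>" "b \<in> \<T>" "a \<le> b" "\<phi> b \<notin> U"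
  shows "\<exists>e\<in>\<T>. a \<le> e \<and> e \<le> b \<and> \<phi> e \<notin> U \<and> (\<forall>t\<in>\<T>. a \<le> t \<longrightarrow> t < e \<longrightarrow> \<phi> t \<in> U)"
  using compact_attains_inf[OF compact_outside_times[OF assms(1-3), of b]] assms by force

lemma last_exit:
  assumes "attractor_solution \<phi>" "open U" "a \<in> \<T>" "b \<in> \<T>" "a \<le> b" "\<phi> a \<notin> U"
  shows "\<exists>e\<in>\<T>. a \<le> e \<and> e \<le> b \<and> \<phi> e \<notin> U \<and> (\<forall>t\<in>\<T>. e < t \<longrightarrow> t \<le> b \<longrightarrow> \<phi> t \<in> U)"
  using compact_attains_sup[OF compact_outside_times[OF assms(1-3), of b]] assms by force

text \<open>Let \<open>e n\<close> be the first exit time after \<open>a n\<close>. If the time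
  spent in \<open>U\<close> before it stayed bounded along the sequence, \<open>limit_step\<close>
  would put \<open>\<psi> 0\<close> on the forward orbit of \<open>p\<close>, which lies in
  \<open>U\<close>. So these times grow without bound, and the limit taken at the exits has its
  whole past in \<open>closure U\<close>.\<close>

lemma exit_limit:
  fixes \<phi> :: "nat \<Rightarrow> real \<Rightarrow> 'x"
  assumes sol: "\<And>n. attractor_solution (\<phi> n)" and U: "open U"
    and times: "\<And>n. a n \<in> \<T>" "\<And>n. b n \<in> \<T>" "\<And>n. a n \<le> b n"
    and start: "(\<lambda>n. \<phi> n (a n)) \<longlonglongrightarrow> p" "\<And>\<delta>. \<delta> \<in> nonneg_times \<T> \<Longrightarrow> S \<delta> p \<in> U"
    and out: "\<And>n. \<phi> n (b n) \<notin> U"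
  obtains e r \<psi> where "\<And>n. e n \<in> \<T>" "\<And>n. a n \<le> e n" "\<And>n. e n \<le> b n" "strict_mono r"
    "attractor_solution \<psi>" "\<And>t. t \<in> \<T> \<Longrightarrow> (\<lambda>n. \<phi> (r n) (e (r n) + t)) \<longlonglongrightarrow> \<psi> t"
    "\<psi> 0 \<notin> U" "\<And>t. t \<in> \<T> \<Longrightarrow> t < 0 \<Longrightarrow> \<psi> t \<in> closure U"
proof -
  have "\<forall>n. \<exists>e. e \<in> \<T> \<and> a n \<le> e \<and> e \<le> b n \<and> \<phi> n e \<notin> U \<and> (\<forall>t\<in>\<T>. a n \<le> t \<longrightarrow> t < e \<longrightarrow> \<phi> n t \<in> U)"
    using first_exit[OF sol U times out] by blast
  then obtain e where e: "\<And>n. e n \<in> \<T>" "\<And>n. a n \<le> e n" "\<And>n. e n \<le> b n" "\<And>n. \<phi> n (e n) \<notin> U"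
      and inside: "\<And>n t. t \<in> \<T> \<Longrightarrow> a n \<le> t \<Longrightarrow> t < e n \<Longrightarrow> \<phi> n t \<in> U"
    by metis
  have "\<And>n. attractor_solution (\<lambda>t. \<phi> n (e n + t))"
    using attractor_solution_shift sol e(1) by blast
  then obtain r \<psi> where r: "strict_mono r" and psi: "attractor_solution \<psi>"
      and lim: "\<And>t. t \<in> \<T> \<Longrightarrow> (\<lambda>n. \<phi> (r n) (e (r n) + t)) \<longlonglongrightarrow> \<psi> t"
    using attractor_solution_limit[of "\<lambda>n t. \<phi> n (e n + t)"] by metis
  have lim0: "(\<lambda>n. \<phi> (r n) (e (r n))) \<longlonglongrightarrow> \<psi> 0"
    using lim[OF times_zero] by simp
  have psi0: "\<psi> 0 \<notin> U"
    using Lim_in_closed_set[of "- U", OF _ _ sequentially_bot lim0] U e(4) by auto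
  have "\<psi> t \<in> closure U" if t: "t \<in> \<T>" "t < 0" for t
  proof (rule ccontr)
    assume "\<psi> t \<notin> closure U"
    then have "\<forall>\<^sub>F n in sequentially. \<phi> (r n) (e (r n) + t) \<in> - closure U"
      by (intro topological_tendstoD[OF lim[OF t(1)]]) auto
    \<comment> \<open>Lying outside \<open>U\<close> before the first exit means lying before
      \<open>a\<close>; this bounds the lag by \<open>- t\<close>.\<close>
    then have "\<forall>\<^sub>F n in sequentially. a (r n) \<le> e (r n) \<and> e (r n) \<le> a (r n) + (- t)"
    proof eventually_elim
      case (elim n)
      then have "\<phi> (r n) (e (r n) + t) \<notin> U"
        using closure_subset[of U] by blast
      then have "\<not> a (r n) \<le> e (r n) + t"
        using inside[OF times_add[OF e(1) t(1)], of "r n" "r n"] t(2) by auto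
      with e show ?case
        by auto
    qed
    moreover have "(\<lambda>n. \<phi> (r n) (a (r n))) \<longlonglongrightarrow> p"
      using LIMSEQ_subseq_LIMSEQ[OF start(1) r] by (simp add: o_def)
    ultimately have "\<exists>\<delta>\<in>nonneg_times \<T>. \<psi> 0 = S \<delta> p"
      using lim0 by (intro limit_step[of "\<phi> \<circ> r" "a \<circ> r" "e \<circ> r" _ _ "- t"]) (auto simp: sol times e)
    with start(2) psi0 show False
      by auto
  qed
  with e r psi lim psi0 that show thesis
    by blast
qed

text \<open>The counterpart of \<open>exit_limit\<close> in reversed time, with the last time
  outside \<open>U\<close>. As \<open>S\<close> need not be invertible, the condition on
  \<open>p\<close> speaks of preimages: a bounded lag between leaving the complement of
  \<open>U\<close> and arriving at \<open>p\<close> would make \<open>\<psi> 0\<close> a point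
  outside \<open>U\<close> that is mapped to \<open>p\<close>.\<close>

lemma entrance_limit:
  fixes \<phi> :: "nat \<Rightarrow> real \<Rightarrow> 'x"
  assumes sol: "\<And>n. attractor_solution (\<phi> n)" and U: "open U"
    and times: "\<And>n. a n \<in> \<T>" "\<And>n. b n \<in> \<T>" "\<And>n. a n \<le> b n"
    and out: "\<And>n. \<phi> n (a n) \<notin> U"
    and target: "(\<lambda>n. \<phi> n (b n)) \<longlonglongrightarrow> p"
      "\<And>\<delta> x. \<delta> \<in> nonneg_times \<T> \<Longrightarrow> x \<in> \<A> \<Longrightarrow> x \<notin> U \<Longrightarrow> S \<delta> x \<noteq> p"
  obtains e r \<psi> where "\<And>n. e n \<in> \<T>" "\<And>n. a n \<le> e n" "\<And>n. e n \<le> b n" "strict_mono r"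
    "attractor_solution \<psi>" "\<And>t. t \<in> \<T> \<Longrightarrow> (\<lambda>n. \<phi> (r n) (e (r n) + t)) \<longlonglongrightarrow> \<psi> t"
    "\<psi> 0 \<notin> U" "\<And>t. t \<in> \<T> \<Longrightarrow> 0 < t \<Longrightarrow> \<psi> t \<in> closure U"
proof -
  have "\<forall>n. \<exists>e. e \<in> \<T> \<and> a n \<le> e \<and> e \<le> b n \<and> \<phi> n e \<notin> U \<and> (\<forall>t\<in>\<T>. e < t \<longrightarrow> t \<le> b n \<longrightarrow> \<phi> n t \<in> U)"
    using last_exit[OF sol U times out] by blast
  then obtain e where e: "\<And>n. e n \<in> \<T>" "\<And>n. a n \<le> e n" "\<And>n. e n \<le> b n" "\<And>n. \<phi> n (e n) \<notin> U"
      and inside: "\<And>n t. t \<in> \<T> \<Longrightarrow> e n < t \<Longrightarrow> t \<le> b n \<Longrightarrow> \<phi> n t \<in> U"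
    by metis
  have "\<And>n. attractor_solution (\<lambda>t. \<phi> n (e n + t))"
    using attractor_solution_shift sol e(1) by blast
  then obtain r \<psi> where r: "strict_mono r" and psi: "attractor_solution \<psi>"
      and lim: "\<And>t. t \<in> \<T> \<Longrightarrow> (\<lambda>n. \<phi> (r n) (e (r n) + t)) \<longlonglongrightarrow> \<psi> t"
    using attractor_solution_limit[of "\<lambda>n t. \<phi> n (e n + t)"] by metis
  have lim0: "(\<lambda>n. \<phi> (r n) (e (r n))) \<longlonglongrightarrow> \<psi> 0"
    using lim[OF times_zero] by simp
  have psi0: "\<psi> 0 \<notin> U"
    using Lim_in_closed_set[of "- U", OF _ _ sequentially_bot lim0] U e(4) by auto
  have "\<psi> t \<in> closure U" if t: "t \<in> \<T>" "0 < t" for t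
  proof (rule ccontr)
    assume "\<psi> t \<notin> closure U"
    then have "\<forall>\<^sub>F n in sequentially. \<phi> (r n) (e (r n) + t) \<in> - closure U"
      by (intro topological_tendstoD[OF lim[OF t(1)]]) auto
    then have "\<forall>\<^sub>F n in sequentially. e (r n) \<le> b (r n) \<and> b (r n) \<le> e (r n) + t"
    proof eventually_elim
      case (elim n)
      then have "\<phi> (r n) (e (r n) + t) \<notin> U"
        using closure_subset[of U] by blast
      then have "\<not> e (r n) + t \<le> b (r n)"
        using inside[OF times_add[OF e(1) t(1)], of "r n" "r n"] t(2) by auto
      with e show ?case
        by auto
    qed
    moreover have "(\<lambda>n. \<phi> (r n) (b (r n))) \<longlonglongrightarrow> p"
      using LIMSEQ_subseq_LIMSEQ[OF target(1) r] by (simp add: o_def)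
    ultimately have "\<exists>\<delta>\<in>nonneg_times \<T>. p = S \<delta> (\<psi> 0)"
      using lim0 by (intro limit_step[of "\<phi> \<circ> r" "e \<circ> r" "b \<circ> r"]) (auto simp: sol times e)
    with target(2) psi0 attractor_solution_in[OF psi times_zero] show False
      by auto
  qed
  with e r psi lim psi0 that show thesis
    by blast
qed

end

section \<open>Lyapunov functions\<close>

text \<open>The neighbourhood from (V5) is fixed as a parameter, which turns the two halves of (V5)
  into the rules \<open>backward_near\<close> and \<open>forward_near\<close>. Empty
  \<open>\<O>\<close> is covered by \<open>U = {}\<close>, where both rules hold vacuously.\<close>

locale lyapunov_semiflow = attracted_semiflow \<T> S \<A>
  for \<T> :: "real set"
    and S :: "real \<Rightarrow> 'x::metric_space \<Rightarrow> 'x"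
    and \<A> :: "'x set" +
  fixes \<O> Xt D \<R> U :: "'x set"
    and dt :: "'x \<Rightarrow> 'x \<Rightarrow> real"
    and V :: "'x \<Rightarrow> enat"
    and Nstar :: nat
  assumes O_subset: "\<O> \<subseteq> \<A>"
    and compact_O: "compact \<O>"
    and invariant_O: "invariant_set \<T> S \<O>"
    and complement_invariant: "t \<in> nonneg_times \<T> \<Longrightarrow> \<xi> \<in> \<A> - \<O> \<Longrightarrow> S t \<xi> \<notin> \<O>"
    and attractor_subset: "\<A> \<subseteq> Xt"
    and attractor_subseq: "(\<And>n::nat. x n \<in> \<A>) \<Longrightarrow> \<xi> \<in> \<A> \<Longrightarrow> x \<longlonglongrightarrow> \<xi> \<Longrightarrow>
      \<exists>r::nat \<Rightarrow> nat. strict_mono r \<and> (\<lambda>k. dt (x (r k)) \<xi>) \<longlonglongrightarrow> 0"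
    and domain: "- \<O> \<subseteq> D"
    and V_lower_semicontinuous: "(\<And>n::nat. x n \<notin> \<O>) \<Longrightarrow> \<xi> \<notin> \<O> \<Longrightarrow> x \<longlonglongrightarrow> \<xi> \<Longrightarrow>
      V \<xi> \<le> liminf (\<lambda>n. V (x n))"
    and V_tendsto_regular: "(\<And>n::nat. x n \<in> Xt - \<O>) \<Longrightarrow> \<xi> \<in> \<R> \<Longrightarrow> (\<lambda>n. dt (x n) \<xi>) \<longlonglongrightarrow> 0 \<Longrightarrow>
      (\<lambda>n. V (x n)) \<longlonglongrightarrow> V \<xi>"
    and V_nonincreasing: "t \<in> nonneg_times \<T> \<Longrightarrow> \<xi> \<notin> \<O> \<Longrightarrow> V (S t \<xi>) \<le> V \<xi>"
    and V_constant_regular: "\<exists>T\<in>nonneg_times \<T>. \<forall>t\<in>nonneg_times \<T>. \<forall>\<xi>.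
      T \<le> t \<longrightarrow> \<xi> \<notin> \<O> \<longrightarrow> V (S t \<xi>) = V \<xi> \<longrightarrow> S t \<xi> \<in> \<R>"
    and open_U: "open U"
    and O_subset_U: "\<O> \<subseteq> U"
    and backward_near: "entire_solution \<T> S \<phi> \<Longrightarrow> (\<And>t. t \<in> \<T> \<Longrightarrow> \<phi> t \<notin> \<O>) \<Longrightarrow> t0 \<in> \<T> \<Longrightarrow>
      (\<And>t. t \<in> \<T> \<Longrightarrow> t \<le> t0 \<Longrightarrow> \<phi> t \<in> closure U \<inter> \<A>) \<Longrightarrow> t \<in> \<T> \<Longrightarrow> V (\<phi> t) \<le> enat Nstar"
    and forward_near: "entire_solution \<T> S \<phi> \<Longrightarrow> (\<And>t. t \<in> \<T> \<Longrightarrow> \<phi> t \<notin> \<O>) \<Longrightarrow> t1 \<in> \<T> \<Longrightarrow>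
      (\<And>t. t \<in> \<T> \<Longrightarrow> t1 \<le> t \<Longrightarrow> \<phi> t \<in> closure U \<inter> \<A>) \<Longrightarrow> t \<in> \<T> \<Longrightarrow> enat Nstar \<le> V (\<phi> t)"
begin

lemma closed_O: "closed \<O>"
  using compact_O compact_imp_closed by blast

lemma S_image_O: "t \<in> nonneg_times \<T> \<Longrightarrow> x \<in> \<O> \<Longrightarrow> S t x \<in> \<O>"
  using invariant_O unfolding invariant_set_def by blast

section \<open>Solutions avoiding \<open>\<O>\<close>\<close>

definition outer_solution :: "(real \<Rightarrow> 'x) \<Rightarrow> bool" where
  "outer_solution \<phi> \<longleftrightarrow> attractor_solution \<phi> \<and> (\<forall>t\<in>\<T>. \<phi> t \<notin> \<O>)"

lemma outer_solutionD:
  assumes "outer_solution \<phi>"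
  shows "attractor_solution \<phi>" "t \<in> \<T> \<Longrightarrow> \<phi> t \<notin> \<O>" "t \<in> \<T> \<Longrightarrow> \<phi> t \<in> \<A>"
  using assms by (auto simp: outer_solution_def attractor_solution_in)

text \<open>After time \<open>s\<close> the complement of \<open>\<O>\<close> in \<open>\<A>\<close>
  is not left; before time \<open>s\<close> the solution cannot be in \<open>\<O>\<close>, since
  invariance would keep it there. So a solution in \<open>\<A>\<close> lies either wholly in
  \<open>\<O>\<close> or wholly outside.\<close>

lemma outer_solutionI:
  assumes "attractor_solution \<phi>" "s \<in> \<T>" "\<phi> s \<notin> \<O>"
  shows "outer_solution \<phi>"
proof -
  have "\<phi> t \<notin> \<O>" if t: "t \<in> \<T>" for t
  proof (cases "s \<le> t")
    case True
    then have "\<phi> t = S (t - s) (\<phi> s)"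
      using attractor_solution_step assms t by blast
    then show ?thesis
      using complement_invariant[of "t - s" "\<phi> s"] True assms t attractor_solution_in[OF assms(1,2)]
      by (auto simp: nonneg_times_iff)
  next
    case False
    then have "\<phi> s = S (s - t) (\<phi> t)"
      using attractor_solution_step assms t by simp
    then show ?thesis
      using S_image_O[of "s - t" "\<phi> t"] False assms t by (auto simp: nonneg_times_iff)
  qed
  with assms show ?thesis
    by (simp add: outer_solution_def)
qed

lemma outer_solution_shift:
  "outer_solution \<phi> \<Longrightarrow> a \<in> \<T> \<Longrightarrow> outer_solution (\<lambda>t. \<phi> (a + t))"
  using attractor_solution_shift by (auto simp: outer_solution_def)

lemma V_near_backward:
  assumes "outer_solution \<phi>" "t0 \<in> \<T>" "\<And>t. t \<in> \<T> \<Longrightarrow> t \<le> t0 \<Longrightarrow> \<phi> t \<in> closure U" "t \<in> \<T>"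
  shows "V (\<phi> t) \<le> enat Nstar"
  using assms backward_near[of \<phi> t0 t]
  by (auto simp: outer_solution_def attractor_solution_def)

lemma V_near_forward:
  assumes "outer_solution \<phi>" "t1 \<in> \<T>" "\<And>t. t \<in> \<T> \<Longrightarrow> t1 \<le> t \<Longrightarrow> \<phi> t \<in> closure U" "t \<in> \<T>"
  shows "enat Nstar \<le> V (\<phi> t)"
  using assms forward_near[of \<phi> t1 t]
  by (auto simp: outer_solution_def attractor_solution_def)

section \<open>\<open>V\<close> along solutions and under limits of solutions\<close>

lemma V_antimono:
  assumes "outer_solution \<phi>" "s \<in> \<T>" "t \<in> \<T>" "s \<le> t"
  shows "V (\<phi> t) \<le> V (\<phi> s)"
  using assms V_nonincreasing[of "t - s" "\<phi> s"] attractor_solution_step[of \<phi> s t]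
  by (auto simp: outer_solution_def nonneg_times_iff)

lemma eventually_in_R:
  assumes "outer_solution \<phi>"
  shows "\<exists>t1\<in>\<T>. \<forall>t\<in>\<T>. t1 \<le> t \<longrightarrow> \<phi> t \<in> \<R>"
proof -
  obtain T where T: "T \<in> \<T>" "0 \<le> T"
      and R: "\<And>\<xi>. \<xi> \<notin> \<O> \<Longrightarrow> V (S T \<xi>) = V \<xi> \<Longrightarrow> S T \<xi> \<in> \<R>"
    using V_constant_regular by (auto simp: nonneg_times_iff)
  \<comment> \<open>A minimum and not merely an infimum: it is attained at some \<open>t0\<close>,
    possibly with value \<open>\<infinity>\<close>, and \<open>V\<close> is constant from
    \<open>t0\<close> on. Waiting another \<open>T\<close> makes \<open>t - T\<close> fall into the
    constant range.\<close>
  define m where "m = (LEAST v. \<exists>t\<in>\<T>. v = V (\<phi> t))"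
  have "\<exists>t\<in>\<T>. m = V (\<phi> t)"
    unfolding m_def by (rule LeastI[of _ "V (\<phi> 0)"]) auto
  then obtain t0 where t0: "t0 \<in> \<T>" "V (\<phi> t0) = m"
    by auto
  have least: "m \<le> V (\<phi> t)" if "t \<in> \<T>" for t
    unfolding m_def using that by (intro Least_le) auto
  have const: "V (\<phi> t) = m" if "t \<in> \<T>" "t0 \<le> t" for t
    using least V_antimono[OF assms t0(1) that] that t0 by (auto intro: antisym)
  show ?thesis
  proof (intro bexI ballI impI)
    fix t assume t: "t \<in> \<T>" "t0 + T \<le> t"
    have tT: "t - T \<in> \<T>"
      using t T by auto
    have "\<phi> t = S T (\<phi> (t - T))"
      using attractor_solution_step[OF outer_solutionD(1)[OF assms] tT t(1)] T by simp
    then show "\<phi> t \<in> \<R>"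
      using R[of "\<phi> (t - T)"] const[of t] const[OF tT] t T outer_solutionD(2)[OF assms tT] by auto
  qed (use t0 T in auto)
qed

lemma V_limit_le:
  assumes "\<And>n. outer_solution (\<phi> n)" "outer_solution \<psi>" "t \<in> \<T>" "(\<lambda>n. \<phi> n t) \<longlonglongrightarrow> \<psi> t"
    and "\<And>n. V (\<phi> n t) \<le> u"
  shows "V (\<psi> t) \<le> u"
proof -
  have "V (\<psi> t) \<le> liminf (\<lambda>n. V (\<phi> n t))"
    using assms by (intro V_lower_semicontinuous) (auto dest: outer_solutionD(2))
  also have "\<dots> \<le> u"
    using assms(5) by (intro Liminf_le) auto
  finally show ?thesis .
qed

text \<open>Convergence of \<open>V\<close> is available only at limit points in
  \<open>\<R>\<close>, and convergence in \<open>dt\<close> only along a subsequence. Hence the late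
  time \<open>t\<close>, at which \<open>\<psi> t\<close> is in \<open>\<R>\<close>, and the
  subsequence \<open>r\<close>.\<close>

lemma V_limit_late:
  assumes "\<And>n. outer_solution (\<phi> n)" "outer_solution \<psi>" "\<And>t. t \<in> \<T> \<Longrightarrow> (\<lambda>n. \<phi> n t) \<longlonglongrightarrow> \<psi> t"
    and "s \<in> \<T>"
  obtains t r where "t \<in> \<T>" "s \<le> t" "strict_mono r" "(\<lambda>n. V (\<phi> (r n) t)) \<longlonglongrightarrow> V (\<psi> t)"
proof -
  obtain t1 where t1: "t1 \<in> \<T>" "\<And>t. t \<in> \<T> \<Longrightarrow> t1 \<le> t \<Longrightarrow> \<psi> t \<in> \<R>"
    using eventually_in_R[OF assms(2)] by blast
  define t where "t = max t1 s"
  have t: "t \<in> \<T>" "t1 \<le> t" "s \<le> t"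
    using t1(1) assms(4) by (auto simp: t_def max_def)
  have A: "\<phi> n t \<in> \<A>" "\<phi> n t \<notin> \<O>" for n
    using outer_solutionD assms(1) t(1) by blast+
  obtain r where r: "strict_mono r" "(\<lambda>n. dt (\<phi> (r n) t) (\<psi> t)) \<longlonglongrightarrow> 0"
    using attractor_subseq[OF _ _ assms(3)[OF t(1)]] A outer_solutionD(3)[OF assms(2) t(1)] by blast
  have "(\<lambda>n. V (\<phi> (r n) t)) \<longlonglongrightarrow> V (\<psi> t)"
    using V_tendsto_regular[OF _ t1(2)[OF t(1,2)] r(2)] A attractor_subset by blast
  with t r that show thesis
    by blast
qed

text \<open>Lower semicontinuity gives no lower bound for \<open>V (\<psi> s)\<close>. The bound is
  obtained at a late time and carried back to \<open>s\<close> by monotonicity, so it is assumed at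
  all times, unlike the bound in \<open>V_limit_le\<close>.\<close>

lemma V_limit_ge:
  assumes "\<And>n. outer_solution (\<phi> n)" "outer_solution \<psi>" "\<And>t. t \<in> \<T> \<Longrightarrow> (\<lambda>n. \<phi> n t) \<longlonglongrightarrow> \<psi> t"
    and "s \<in> \<T>" "\<And>n t. t \<in> \<T> \<Longrightarrow> l \<le> V (\<phi> n t)"
  shows "l \<le> V (\<psi> s)"
proof -
  obtain t r where t: "t \<in> \<T>" "s \<le> t" "(\<lambda>n. V (\<phi> (r n) t)) \<longlonglongrightarrow> V (\<psi> t)"
    using V_limit_late[OF assms(1-4)] by blast
  have "l \<le> V (\<psi> t)"
    using assms(5)[OF t(1)] by (intro LIMSEQ_le_const[OF t(3)]) auto
  also have "\<dots> \<le> V (\<psi> s)"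
    using V_antimono assms t by blast
  finally show ?thesis .
qed

lemma V_limit_eq:
  assumes "\<And>n. outer_solution (\<phi> n)" "outer_solution \<psi>" "\<And>t. t \<in> \<T> \<Longrightarrow> (\<lambda>n. \<phi> n t) \<longlonglongrightarrow> \<psi> t"
    and "\<And>t. t \<in> \<T> \<Longrightarrow> (\<lambda>n. V (\<phi> n t)) \<longlonglongrightarrow> L" "s \<in> \<T>"
  shows "V (\<psi> s) = L"
proof (rule antisym)
  have "V (\<psi> s) \<le> liminf (\<lambda>n. V (\<phi> n s))"
    using assms by (intro V_lower_semicontinuous) (auto dest: outer_solutionD(2))
  also have "\<dots> = L"
    using assms(4)[OF assms(5)] by (intro lim_imp_Liminf) auto
  finally show "V (\<psi> s) \<le> L" .
next
  obtain t r where t: "t \<in> \<T>" "s \<le> t" "strict_mono r" "(\<lambda>n. V (\<phi> (r n) t)) \<longlonglongrightarrow> V (\<psi> t)"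
    using V_limit_late[OF assms(1-3,5)] by blast
  have "(\<lambda>n. V (\<phi> (r n) t)) \<longlonglongrightarrow> L"
    using LIMSEQ_subseq_LIMSEQ[OF assms(4)[OF t(1)] t(3)] by (simp add: o_def)
  then have "V (\<psi> t) = L"
    using LIMSEQ_unique t(4) by blast
  then show "L \<le> V (\<psi> s)"
    using V_antimono[OF assms(2,5) t(1,2)] by simp
qed

section \<open>Limits of \<open>V\<close> at the two ends of time\<close>

definition V_end :: "real \<Rightarrow> (real \<Rightarrow> 'x) \<Rightarrow> enat" where
  "V_end \<sigma> \<phi> = (if \<sigma> = 1 then INF t\<in>\<T>. V (\<phi> t) else SUP t\<in>\<T>. V (\<phi> t))"

lemma V_end_bounds: "t \<in> \<T> \<Longrightarrow> V_end 1 \<phi> \<le> V (\<phi> t)" "t \<in> \<T> \<Longrightarrow> V (\<phi> t) \<le> V_end (-1) \<phi>"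
  by (auto simp: V_end_def intro: INF_lower SUP_upper)

lemma V_end_ge: "(\<And>t. t \<in> \<T> \<Longrightarrow> l \<le> V (\<phi> t)) \<Longrightarrow> l \<le> V_end \<sigma> \<phi>"
  by (auto simp: V_end_def intro: INF_greatest SUP_upper2[OF times_zero])

lemma V_end_le: "(\<And>t. t \<in> \<T> \<Longrightarrow> V (\<phi> t) \<le> u) \<Longrightarrow> V_end \<sigma> \<phi> \<le> u"
  by (auto simp: V_end_def intro: INF_lower2[OF times_zero] SUP_least)

lemma V_tendsto_end:
  assumes \<phi>: "outer_solution \<phi>" and \<sigma>: "\<sigma> \<in> {1, -1}" and \<tau>: "\<And>n. \<tau> n \<in> \<T>"
    and far: "filterlim (\<lambda>n. \<sigma> * \<tau> n) at_top sequentially"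
  shows "(\<lambda>n. V (\<phi> (\<tau> n))) \<longlonglongrightarrow> V_end \<sigma> \<phi>"
  using \<sigma>
proof (elim insertE emptyE)
  assume s: "\<sigma> = 1"
  show ?thesis
  proof (rule order_tendstoI)
    fix a assume "a < V_end \<sigma> \<phi>"
    then show "\<forall>\<^sub>F n in sequentially. a < V (\<phi> (\<tau> n))"
      using V_end_bounds(1)[OF \<tau>] s by (intro always_eventually) (auto intro: less_le_trans)
  next
    fix a assume "V_end \<sigma> \<phi> < a"
    then obtain t where t: "t \<in> \<T>" "V (\<phi> t) < a"
      by (auto simp: V_end_def s INF_less_iff)
    have "\<forall>\<^sub>F n in sequentially. t \<le> \<tau> n"
      using far s by (simp add: filterlim_at_top)
    then show "\<forall>\<^sub>F n in sequentially. V (\<phi> (\<tau> n)) < a"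
      by eventually_elim (use V_antimono[OF \<phi> t(1) \<tau>] t(2) in \<open>auto intro: le_less_trans\<close>)
  qed
next
  assume s: "\<sigma> = -1"
  show ?thesis
  proof (rule order_tendstoI)
    fix a assume "V_end \<sigma> \<phi> < a"
    then show "\<forall>\<^sub>F n in sequentially. V (\<phi> (\<tau> n)) < a"
      using V_end_bounds(2)[OF \<tau>] s by (intro always_eventually) (auto intro: le_less_trans)
  next
    fix a assume "a < V_end \<sigma> \<phi>"
    then obtain t where t: "t \<in> \<T>" "a < V (\<phi> t)"
      by (auto simp: V_end_def s less_SUP_iff)
    have "\<forall>\<^sub>F n in sequentially. - t \<le> - \<tau> n"
      using far[unfolded s filterlim_at_top, rule_format, of "- t"] by simp
    then show "\<forall>\<^sub>F n in sequentially. a < V (\<phi> (\<tau> n))"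
      by eventually_elim (use V_antimono[OF \<phi> \<tau> t(1)] t(2) in \<open>auto intro: less_le_trans\<close>)
  qed
qed

text \<open>At each fixed time the values of \<open>V\<close> along the translates tend to the same
  end value, so the limit in \<open>V_limit_eq\<close> does not depend on the time.\<close>

lemma V_on_limit:
  assumes "outer_solution \<phi>" "\<sigma> \<in> {1, -1}" "outer_solution \<psi>" "\<And>n. \<tau> n \<in> \<T>"
    and "filterlim (\<lambda>n. \<sigma> * \<tau> n) at_top sequentially"
    and "\<And>t. t \<in> \<T> \<Longrightarrow> (\<lambda>n. \<phi> (\<tau> n + t)) \<longlonglongrightarrow> \<psi> t" "s \<in> \<T>"
  shows "V (\<psi> s) = V_end \<sigma> \<phi>"
  using assms outer_solution_shift far_shift
  by (intro V_limit_eq[of "\<lambda>n t. \<phi> (\<tau> n + t)"] V_tendsto_end) auto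

lemma limit_set_level:
  assumes "outer_solution \<phi>" "\<sigma> \<in> {1, -1}" "\<eta> \<in> limit_set \<sigma> \<phi>" "\<eta> \<notin> \<O>"
  obtains \<psi> where "outer_solution \<psi>" "\<psi> 0 = \<eta>"
    "\<And>t. t \<in> \<T> \<Longrightarrow> \<psi> t \<in> limit_set \<sigma> \<phi>" "\<And>t. t \<in> \<T> \<Longrightarrow> V (\<psi> t) = V_end \<sigma> \<phi>"
proof -
  obtain \<tau> \<psi> where psi: "attractor_solution \<psi>" "\<psi> 0 = \<eta>" "\<And>n. \<tau> n \<in> \<T>"
    "\<And>t. t \<in> \<T> \<Longrightarrow> (\<lambda>n. \<phi> (\<tau> n + t)) \<longlonglongrightarrow> \<psi> t"
    "\<And>t. t \<in> \<T> \<Longrightarrow> filterlim (\<lambda>n. \<sigma> * (\<tau> n + t)) at_top sequentially"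
    "\<And>t. t \<in> \<T> \<Longrightarrow> \<psi> t \<in> limit_set \<sigma> \<phi>"
    by (rule limit_set_solution[OF outer_solutionD(1)[OF assms(1)] assms(3)]) blast
  have out: "outer_solution \<psi>"
    using outer_solutionI[OF psi(1) times_zero] psi(2) assms(4) by simp
  have far: "filterlim (\<lambda>n. \<sigma> * \<tau> n) at_top sequentially"
    using psi(5)[OF times_zero] by simp
  show thesis
    using that[OF out psi(2,6) V_on_limit[OF assms(1,2) out psi(3) far psi(4)]] .
qed

text \<open>A solution inside the limit set stays in \<open>closure U\<close> for all times, so both
  halves of (V5) apply to it and squeeze its value of \<open>V\<close>, which is the end
  value.\<close>

lemma limit_set_near:
  assumes "outer_solution \<phi>" "\<sigma> \<in> {1, -1}" "limit_set \<sigma> \<phi> \<subseteq> closure U" "\<not> limit_set \<sigma> \<phi> \<subseteq> \<O>"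
  shows "V_end \<sigma> \<phi> = enat Nstar"
proof -
  obtain \<eta> where "\<eta> \<in> limit_set \<sigma> \<phi>" "\<eta> \<notin> \<O>"
    using assms(4) by blast
  then obtain \<psi> where psi: "outer_solution \<psi>"
    "\<And>t. t \<in> \<T> \<Longrightarrow> \<psi> t \<in> limit_set \<sigma> \<phi>" "\<And>t. t \<in> \<T> \<Longrightarrow> V (\<psi> t) = V_end \<sigma> \<phi>"
    using limit_set_level[OF assms(1,2)] by metis
  have "\<And>t. t \<in> \<T> \<Longrightarrow> \<psi> t \<in> closure U"
    using psi(2) assms(3) by blast
  then have "V (\<psi> 0) \<le> enat Nstar" "enat Nstar \<le> V (\<psi> 0)"
    using V_near_backward[OF psi(1) times_zero _ times_zero]
      V_near_forward[OF psi(1) times_zero _ times_zero] by blast+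
  then show ?thesis
    using psi(3)[OF times_zero] by (simp add: antisym)
qed

text \<open>Visits near \<open>p\<close> and times outside \<open>U\<close> both recur without end.
  Exits after visits give the upper bound through \<open>V_near_backward\<close>, entrances before
  visits the lower bound through \<open>V_near_forward\<close>; both limit solutions have the end
  value as their value of \<open>V\<close>.\<close>

lemma limit_set_exits:
  assumes \<phi>: "outer_solution \<phi>" and \<sigma>: "\<sigma> \<in> {1, -1}" and p: "p \<in> limit_set \<sigma> \<phi>" "p \<in> \<O>"
    and exits: "\<And>c. \<exists>t\<in>\<T>. c \<le> \<sigma> * t \<and> \<phi> t \<notin> U"
  shows "V_end \<sigma> \<phi> = enat Nstar"
proof (rule antisym)
  have sol: "attractor_solution \<phi>"
    using \<phi> by (simp add: outer_solution_def)
  obtain a where a: "\<And>n. a n \<in> \<T>" "filterlim (\<lambda>n. \<sigma> * a n) at_top sequentially" "(\<lambda>n. \<phi> (a n)) \<longlonglongrightarrow> p"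
    using p(1) by (auto simp: limit_set_def)
  obtain b where b: "\<And>n. b n \<in> \<T>" "filterlim (\<lambda>n. \<sigma> * b n) at_top sequentially" "\<And>n. \<phi> (b n) \<notin> U"
    using unbounded_times_sequence[of \<sigma> "\<lambda>_ t. \<phi> t \<notin> U"] exits by metis
  have outer: "outer_solution \<psi>" if "attractor_solution \<psi>" "\<psi> 0 \<notin> U" for \<psi>
    using outer_solutionI[OF that(1) times_zero] that(2) O_subset_U by blast
  show "V_end \<sigma> \<phi> \<le> enat Nstar"
  proof -
    obtain k m where k: "filterlim k sequentially sequentially" "filterlim m sequentially sequentially"
        "\<And>n. a (k n) \<le> b (m n)"
      using interlace[OF \<sigma> a(2) b(2)] by blast
    have "(\<lambda>n. \<phi> (a (k n))) \<longlonglongrightarrow> p"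
      using filterlim_compose[OF a(3) k(1)] .
    moreover have "\<And>\<delta>. \<delta> \<in> nonneg_times \<T> \<Longrightarrow> S \<delta> p \<in> U"
      using S_image_O[OF _ p(2)] O_subset_U by blast
    ultimately obtain e r \<psi> where e: "\<And>n. e n \<in> \<T>" "\<And>n. a (k n) \<le> e n" "\<And>n. e n \<le> b (m n)"
        and r: "strict_mono r" and psi: "attractor_solution \<psi>" "\<And>t. t \<in> \<T> \<Longrightarrow> (\<lambda>n. \<phi> (e (r n) + t)) \<longlonglongrightarrow> \<psi> t"
        "\<psi> 0 \<notin> U" "\<And>t. t \<in> \<T> \<Longrightarrow> t < 0 \<Longrightarrow> \<psi> t \<in> closure U"
      by (rule exit_limit[of "\<lambda>_. \<phi>" U "\<lambda>n. a (k n)" "\<lambda>n. b (m n)" p, OF sol open_U a(1) b(1) k(3) _ _ b(3)]) blast+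
    have "filterlim (\<lambda>n. \<sigma> * e n) at_top sequentially"
      using far_between[OF \<sigma> filterlim_compose[OF a(2) k(1)] filterlim_compose[OF b(2) k(2)] e(2,3)] .
    then have "filterlim (\<lambda>n. \<sigma> * e (r n)) at_top sequentially"
      using filterlim_compose filterlim_subseq[OF r] by blast
    then have "V (\<psi> 0) = V_end \<sigma> \<phi>"
      using V_on_limit[OF \<phi> \<sigma> outer[OF psi(1,3)], of "\<lambda>n. e (r n)"] e(1) psi(2) by simp
    \<comment> \<open>The time \<open>-1\<close> and not 0 is the threshold: \<open>\<psi> 0\<close>
      lies outside \<open>U\<close> and only strictly negative times are known to stay in
      \<open>closure U\<close>.\<close>
    moreover have "V (\<psi> 0) \<le> enat Nstar"
      using psi(4) times_uminus[OF times_one]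
      by (intro V_near_backward[OF outer[OF psi(1,3)], of "-1"]) auto
    ultimately show ?thesis
      by simp
  qed
  show "enat Nstar \<le> V_end \<sigma> \<phi>"
  proof -
    obtain k m where k: "filterlim k sequentially sequentially" "filterlim m sequentially sequentially"
        "\<And>n. b (k n) \<le> a (m n)"
      using interlace[OF \<sigma> b(2) a(2)] by blast
    have "(\<lambda>n. \<phi> (a (m n))) \<longlonglongrightarrow> p"
      using filterlim_compose[OF a(3) k(2)] .
    moreover have "S \<delta> x \<noteq> p" if "\<delta> \<in> nonneg_times \<T>" "x \<in> \<A>" "x \<notin> U" for \<delta> x
      using complement_invariant[of \<delta> x] that p(2) O_subset_U by blast
    ultimately obtain e r \<psi> where e: "\<And>n. e n \<in> \<T>" "\<And>n. b (k n) \<le> e n" "\<And>n. e n \<le> a (m n)"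
        and r: "strict_mono r" and psi: "attractor_solution \<psi>" "\<And>t. t \<in> \<T> \<Longrightarrow> (\<lambda>n. \<phi> (e (r n) + t)) \<longlonglongrightarrow> \<psi> t"
        "\<psi> 0 \<notin> U" "\<And>t. t \<in> \<T> \<Longrightarrow> 0 < t \<Longrightarrow> \<psi> t \<in> closure U"
      by (rule entrance_limit[of "\<lambda>_. \<phi>" U "\<lambda>n. b (k n)" "\<lambda>n. a (m n)" p, OF sol open_U b(1) a(1) k(3) b(3)]) blast+
    have "filterlim (\<lambda>n. \<sigma> * e n) at_top sequentially"
      using far_between[OF \<sigma> filterlim_compose[OF b(2) k(1)] filterlim_compose[OF a(2) k(2)] e(2,3)] .
    then have "filterlim (\<lambda>n. \<sigma> * e (r n)) at_top sequentially"
      using filterlim_compose filterlim_subseq[OF r] by blast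
    then have "V (\<psi> 0) = V_end \<sigma> \<phi>"
      using V_on_limit[OF \<phi> \<sigma> outer[OF psi(1,3)], of "\<lambda>n. e (r n)"] e(1) psi(2) by simp
    moreover have "enat Nstar \<le> V (\<psi> 0)"
      using psi(4) by (intro V_near_forward[OF outer[OF psi(1,3)], of 1]) auto
    ultimately show ?thesis
      by simp
  qed
qed

text \<open>Either the solution leaves \<open>U\<close> again and again, or it finally stays in
  \<open>U\<close> and its limit set lies in \<open>closure U\<close>. In the second case a limit
  point off \<open>\<O>\<close> carries the end value.\<close>

lemma limit_set_meets_O:
  assumes "outer_solution \<phi>" "\<sigma> \<in> {1, -1}" "limit_set \<sigma> \<phi> \<inter> \<O> \<noteq> {}" "\<not> limit_set \<sigma> \<phi> \<subseteq> \<O>"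
  shows "V_end \<sigma> \<phi> = enat Nstar"
proof (cases "\<forall>c. \<exists>t\<in>\<T>. c \<le> \<sigma> * t \<and> \<phi> t \<notin> U")
  case True
  then show ?thesis
    using limit_set_exits[OF assms(1,2)] assms(3) by blast
next
  case False
  then obtain c where "\<And>t. t \<in> \<T> \<Longrightarrow> c \<le> \<sigma> * t \<Longrightarrow> \<phi> t \<in> closure U"
    using closure_subset[of U] by blast
  then have "limit_set \<sigma> \<phi> \<subseteq> closure U"
    by (intro limit_set_subset) auto
  then show ?thesis
    using limit_set_near assms by blast
qed

text \<open>A solution that finally stays in \<open>U\<close> is itself subject to (V5). This also
  covers limit sets inside \<open>\<O>\<close>, at the price of a one-sided estimate, which suffices
  to order the Morse indices.\<close>

lemma omega_meets_O:
  assumes "outer_solution \<phi>" "limit_set 1 \<phi> \<inter> \<O> \<noteq> {}" "t \<in> \<T>"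
  shows "enat Nstar \<le> V (\<phi> t)"
proof (cases "\<forall>c. \<exists>t\<in>\<T>. c \<le> 1 * t \<and> \<phi> t \<notin> U")
  case True
  then have "V_end 1 \<phi> = enat Nstar"
    using limit_set_exits[OF assms(1), of 1] assms(2) by blast
  then show ?thesis
    using V_end_bounds(1)[OF assms(3)] by metis
next
  case False
  then obtain c where c: "\<And>t. t \<in> \<T> \<Longrightarrow> c \<le> t \<Longrightarrow> \<phi> t \<in> closure U"
    using closure_subset[of U] by auto
  obtain t1 where "t1 \<in> \<T>" "c \<le> t1"
    using times_unbounded[of 1 c] by auto
  then show ?thesis
    using c assms by (intro V_near_forward[of \<phi> t1]) auto
qed

lemma alpha_meets_O:
  assumes "outer_solution \<phi>" "limit_set (-1) \<phi> \<inter> \<O> \<noteq> {}" "t \<in> \<T>"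
  shows "V (\<phi> t) \<le> enat Nstar"
proof (cases "\<forall>c. \<exists>t\<in>\<T>. c \<le> -1 * t \<and> \<phi> t \<notin> U")
  case True
  then have "V_end (-1) \<phi> = enat Nstar"
    using limit_set_exits[OF assms(1), of "-1"] assms(2) by blast
  then show ?thesis
    using V_end_bounds(2)[OF assms(3)] by metis
next
  case False
  then obtain c where c: "\<And>t. t \<in> \<T> \<Longrightarrow> c \<le> - t \<Longrightarrow> \<phi> t \<in> closure U"
    using closure_subset[of U] by auto
  obtain t0 where "t0 \<in> \<T>" "c \<le> - t0"
    using times_unbounded[of "-1" c] by auto
  then show ?thesis
    using c assms by (intro V_near_backward[of \<phi> t0]) auto
qed

section \<open>The Morse sets\<close>

text \<open>The Morse sets other than the critical one are band sets, with \<open>l = u = n\<close> or \<open>u = \<infinity>\<close>.\<close>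

definition band_set :: "enat \<Rightarrow> enat \<Rightarrow> 'x set" where
  "band_set l u = {\<xi>. \<exists>\<phi>. outer_solution \<phi> \<and> \<phi> 0 = \<xi> \<and> (\<forall>t\<in>\<T>. l \<le> V (\<phi> t) \<and> V (\<phi> t) \<le> u) \<and>
     (\<forall>\<sigma>\<in>{1, -1}. limit_set \<sigma> \<phi> \<inter> \<O> = {})}"

text \<open>The limit sets are left unrestricted: solutions at level \<open>Nstar\<close> may tend
  to \<open>\<O>\<close>, and adjoining \<open>\<O>\<close> gives a closed set.\<close>

definition critical_set :: "'x set" where
  "critical_set = {\<xi>. \<exists>\<phi>. outer_solution \<phi> \<and> \<phi> 0 = \<xi> \<and> (\<forall>t\<in>\<T>. V (\<phi> t) = enat Nstar)}"

lemma band_set_solution: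
  assumes "outer_solution \<phi>" "\<And>t. t \<in> \<T> \<Longrightarrow> l \<le> V (\<phi> t)" "\<And>t. t \<in> \<T> \<Longrightarrow> V (\<phi> t) \<le> u"
    and "\<And>\<sigma>. \<sigma> \<in> {1, -1} \<Longrightarrow> limit_set \<sigma> \<phi> \<inter> \<O> = {}" "t \<in> \<T>"
  shows "\<phi> t \<in> band_set l u"
proof -
  have "outer_solution (\<lambda>s. \<phi> (t + s)) \<and> \<phi> (t + 0) = \<phi> t \<and>
    (\<forall>s\<in>\<T>. l \<le> V (\<phi> (t + s)) \<and> V (\<phi> (t + s)) \<le> u) \<and>
    (\<forall>\<sigma>\<in>{1, -1}. limit_set \<sigma> (\<lambda>s. \<phi> (t + s)) \<inter> \<O> = {})"
    using outer_solution_shift[OF assms(1,5)] limit_set_shift[OF assms(5), of _ \<phi>]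
      assms(2,3)[OF times_add[OF assms(5)]] assms(4) by simp
  then show ?thesis
    unfolding band_set_def by blast
qed

lemma critical_set_solution:
  assumes "outer_solution \<phi>" "\<And>t. t \<in> \<T> \<Longrightarrow> V (\<phi> t) = enat Nstar" "t \<in> \<T>"
  shows "\<phi> t \<in> critical_set"
proof -
  have "outer_solution (\<lambda>s. \<phi> (t + s)) \<and> \<phi> (t + 0) = \<phi> t \<and> (\<forall>s\<in>\<T>. V (\<phi> (t + s)) = enat Nstar)"
    using outer_solution_shift[OF assms(1,3)] assms(2)[OF times_add[OF assms(3)]] by simp
  then show ?thesis
    unfolding critical_set_def by blast
qed

lemma band_set_subset: "band_set l u \<subseteq> \<A> - \<O>"
  and critical_set_subset: "critical_set \<subseteq> \<A> - \<O>"
  using outer_solutionD(2,3)[OF _ times_zero] by (auto simp: band_set_def critical_set_def)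

lemma level_set_eq: "level_set \<T> S \<A> \<O> D V n = band_set (enat n) (enat n)"
  and upper_level_set_eq: "upper_level_set \<T> S \<A> \<O> D V n = band_set (enat n) \<infinity>"
proof -
  \<comment> \<open>The condition \<open>P\<close> on the values of \<open>V\<close> is arbitrary,
    so that the level sets and the upper level set are treated together.\<close>
  have *: "\<xi> \<in> \<A> - \<O> \<and> (\<exists>\<phi>. bounded_entire_solution_through \<T> S \<xi> \<phi> \<and> (\<forall>t\<in>\<T>. \<phi> t \<in> D \<and> P (V (\<phi> t))) \<and>
      (alpha_limit \<T> \<phi> \<union> omega_limit \<T> S \<xi>) \<inter> \<O> = {}) \<longleftrightarrow>
    (\<exists>\<phi>. outer_solution \<phi> \<and> \<phi> 0 = \<xi> \<and> (\<forall>t\<in>\<T>. P (V (\<phi> t))) \<and> (\<forall>\<sigma>\<in>{1, -1}. limit_set \<sigma> \<phi> \<inter> \<O> = {}))"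
    (is "?L \<longleftrightarrow> ?R") for \<xi> P
  proof
    assume ?L
    then show ?R
      using outer_solutionI[OF _ times_zero] omega_limit_eq
      by (fastforce simp: bounded_entire_solution_through_iff alpha_limit_eq)
  next
    assume ?R
    then obtain \<phi> where "outer_solution \<phi>" "\<phi> 0 = \<xi>" "\<forall>t\<in>\<T>. P (V (\<phi> t))"
      "\<forall>\<sigma>\<in>{1, -1}. limit_set \<sigma> \<phi> \<inter> \<O> = {}"
      by blast
    then show ?L
      using outer_solutionD[of \<phi>] outer_solutionD(2,3)[of \<phi> 0] omega_limit_eq[of \<phi>] domain
      by (auto simp: bounded_entire_solution_through_iff alpha_limit_eq intro!: exI[of _ \<phi>])
  qed
  show "level_set \<T> S \<A> \<O> D V n = band_set (enat n) (enat n)"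
    using *[of _ "\<lambda>v. v = enat n"] by (auto simp: level_set_def band_set_def eq_iff[of _ "enat n"])
  show "upper_level_set \<T> S \<A> \<O> D V n = band_set (enat n) \<infinity>"
    using *[of _ "\<lambda>v. enat n \<le> v"] by (auto simp: upper_level_set_def band_set_def)
qed

lemma critical_level_set_eq: "critical_level_set \<T> S \<A> \<O> D V Nstar = \<O> \<union> critical_set"
proof -
  have "\<xi> \<in> \<A> - \<O> \<and> (\<exists>\<phi>. bounded_entire_solution_through \<T> S \<xi> \<phi> \<and>
      (\<forall>t\<in>\<T>. \<phi> t \<in> D \<and> V (\<phi> t) = enat Nstar)) \<longleftrightarrow> \<xi> \<in> critical_set" (is "?L \<longleftrightarrow> ?R") for \<xi>
  proof
    assume ?L
    then show ?R
      using outer_solutionI[OF _ times_zero]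
      by (fastforce simp: bounded_entire_solution_through_iff critical_set_def)
  next
    assume ?R
    then obtain \<phi> where "outer_solution \<phi>" "\<phi> 0 = \<xi>" "\<forall>t\<in>\<T>. V (\<phi> t) = enat Nstar"
      by (auto simp: critical_set_def)
    then show ?L
      using outer_solutionD[of \<phi>] outer_solutionD(2,3)[of \<phi> 0] domain
      by (auto simp: bounded_entire_solution_through_iff intro!: exI[of _ \<phi>])
  qed
  then show ?thesis
    by (auto simp: critical_level_set_def)
qed

section \<open>Invariance and closedness of the candidate sets\<close>

lemma invariant_setI:
  assumes "\<And>\<xi>. \<xi> \<in> B \<Longrightarrow> \<exists>\<phi>. attractor_solution \<phi> \<and> \<phi> 0 = \<xi> \<and> (\<forall>t\<in>\<T>. \<phi> t \<in> B)"
  shows "invariant_set \<T> S B"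
proof -
  have "S t ` B = B" if t: "t \<in> \<T>" "0 \<le> t" for t
  proof (intro equalityI subsetI)
    fix x assume "x \<in> S t ` B"
    then obtain \<xi> \<phi> where "x = S t \<xi>" "attractor_solution \<phi>" "\<phi> 0 = \<xi>" "\<forall>t\<in>\<T>. \<phi> t \<in> B"
      using assms by blast
    then show "x \<in> B"
      using attractor_solution_step[of \<phi> 0 t] t by auto
  next
    fix x assume "x \<in> B"
    then obtain \<phi> where \<phi>: "attractor_solution \<phi>" "\<phi> 0 = x" "\<forall>t\<in>\<T>. \<phi> t \<in> B"
      using assms by blast
    then have "x = S t (\<phi> (- t))"
      using attractor_solution_step[of \<phi> "- t" 0] t times_uminus by auto
    then show "x \<in> S t ` B"
      using \<phi>(3) times_uminus[OF t(1)] by blast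
  qed
  then show ?thesis
    by (auto simp: invariant_set_def nonneg_times_iff)
qed

lemma invariant_band_set: "invariant_set \<T> S (band_set l u)"
proof (rule invariant_setI)
  fix \<xi> assume "\<xi> \<in> band_set l u"
  then obtain \<phi> where "outer_solution \<phi>" "\<phi> 0 = \<xi>" "\<forall>t\<in>\<T>. l \<le> V (\<phi> t) \<and> V (\<phi> t) \<le> u"
    "\<forall>\<sigma>\<in>{1, -1}. limit_set \<sigma> \<phi> \<inter> \<O> = {}"
    by (auto simp: band_set_def)
  then show "\<exists>\<phi>. attractor_solution \<phi> \<and> \<phi> 0 = \<xi> \<and> (\<forall>t\<in>\<T>. \<phi> t \<in> band_set l u)"
    using band_set_solution[of \<phi> l u] by (intro exI[of _ \<phi>]) (auto simp: outer_solutionD(1))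
qed

lemma invariant_critical_set: "invariant_set \<T> S critical_set"
proof (rule invariant_setI)
  fix \<xi> assume "\<xi> \<in> critical_set"
  then obtain \<phi> where "outer_solution \<phi>" "\<phi> 0 = \<xi>" "\<forall>t\<in>\<T>. V (\<phi> t) = enat Nstar"
    by (auto simp: critical_set_def)
  then show "\<exists>\<phi>. attractor_solution \<phi> \<and> \<phi> 0 = \<xi> \<and> (\<forall>t\<in>\<T>. \<phi> t \<in> critical_set)"
    using critical_set_solution[of \<phi>] by (intro exI[of _ \<phi>]) (auto simp: outer_solutionD(1))
qed

text \<open>Staying in \<open>U\<close> would put the limit set into \<open>closure U\<close>, and
  it is off \<open>\<O>\<close>; then the end value is \<open>Nstar\<close>, which lies outside the
  band.\<close>

lemma outer_solution_leaves:
  assumes "outer_solution \<phi>" "\<And>t. t \<in> \<T> \<Longrightarrow> l \<le> V (\<phi> t)" "\<And>t. t \<in> \<T> \<Longrightarrow> V (\<phi> t) \<le> u"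
    and "limit_set \<sigma> \<phi> \<inter> \<O> = {}" "\<sigma> \<in> {1, -1}" "u < enat Nstar \<or> enat Nstar < l"
  shows "\<exists>t\<in>\<T>. 0 \<le> \<sigma> * t \<and> \<phi> t \<notin> U"
proof (rule ccontr)
  assume "\<not> ?thesis"
  then have "limit_set \<sigma> \<phi> \<subseteq> closure U"
    using closure_subset[of U] by (intro limit_set_subset[of _ 0]) auto
  moreover have "\<not> limit_set \<sigma> \<phi> \<subseteq> \<O>"
    using assms(4,5) limit_set_nonempty[OF outer_solutionD(1)[OF assms(1)]] by blast
  ultimately have "V_end \<sigma> \<phi> = enat Nstar"
    using limit_set_near assms by blast
  then show False
    using V_end_le[of \<phi> u \<sigma>] V_end_ge[of l \<phi> \<sigma>] assms(2,3,6) by auto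
qed

text \<open>Solutions in a band away from \<open>Nstar\<close> that start close to \<open>\<O>\<close> leave \<open>U\<close> in both time
  directions. The limits taken at the exit times stay in \<open>U\<close> for all negative, respectively
  all positive, times, which pins \<open>V\<close> from both sides of \<open>Nstar\<close>.\<close>

lemma band_set_isolated:
  assumes "u < enat Nstar \<or> enat Nstar < l"
  shows "closure (band_set l u) \<inter> \<O> = {}"
proof (rule ccontr)
  assume "closure (band_set l u) \<inter> \<O> \<noteq> {}"
  then obtain p where p: "p \<in> \<O>" "p \<in> closure (band_set l u)"
    by blast
  from p(2) obtain x where x: "\<And>n. x n \<in> band_set l u" "x \<longlonglongrightarrow> p"
    unfolding closure_sequential by blast
  have "\<forall>n. \<exists>\<phi>. outer_solution \<phi> \<and> \<phi> 0 = x n \<and> (\<forall>t\<in>\<T>. l \<le> V (\<phi> t) \<and> V (\<phi> t) \<le> u) \<and>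
      (\<forall>\<sigma>\<in>{1, -1}. limit_set \<sigma> \<phi> \<inter> \<O> = {})"
    using x(1) by (auto simp: band_set_def)
  then obtain \<phi> where \<phi>: "\<And>n. outer_solution (\<phi> n)" "\<And>n. \<phi> n 0 = x n"
      "\<And>n t. t \<in> \<T> \<Longrightarrow> l \<le> V (\<phi> n t)" "\<And>n t. t \<in> \<T> \<Longrightarrow> V (\<phi> n t) \<le> u"
      "\<And>n \<sigma>. \<sigma> \<in> {1, -1} \<Longrightarrow> limit_set \<sigma> (\<phi> n) \<inter> \<O> = {}"
    by metis
  have sol: "\<And>n. attractor_solution (\<phi> n)"
    using \<phi>(1) by (simp add: outer_solution_def)
  have lim: "(\<lambda>n. \<phi> n 0) \<longlonglongrightarrow> p"
    using x(2) \<phi>(2) by simp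
  have leaves: "\<exists>t. t \<in> \<T> \<and> 0 \<le> \<sigma> * t \<and> \<phi> n t \<notin> U" if "\<sigma> \<in> {1, -1}" for \<sigma> n
    using outer_solution_leaves[OF \<phi>(1,3,4) \<phi>(5)[OF that] that assms] by blast
  have outer: "outer_solution \<psi>" if "attractor_solution \<psi>" "\<psi> 0 \<notin> U" for \<psi>
    using outer_solutionI[OF that(1) times_zero] that(2) O_subset_U by blast
  have "\<forall>n. \<exists>t. t \<in> \<T> \<and> 0 \<le> t \<and> \<phi> n t \<notin> U"
    using leaves[of 1] by simp
  then obtain b where b: "\<And>n. b n \<in> \<T>" "\<And>n. 0 \<le> b n" "\<And>n. \<phi> n (b n) \<notin> U"
    by metis
  have "\<And>\<delta>. \<delta> \<in> nonneg_times \<T> \<Longrightarrow> S \<delta> p \<in> U"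
    using S_image_O[OF _ p(1)] O_subset_U by blast
  then obtain e r \<psi> where e: "\<And>n. e n \<in> \<T>" and psi: "attractor_solution \<psi>"
      "\<And>t. t \<in> \<T> \<Longrightarrow> (\<lambda>n. \<phi> (r n) (e (r n) + t)) \<longlonglongrightarrow> \<psi> t"
      "\<psi> 0 \<notin> U" "\<And>t. t \<in> \<T> \<Longrightarrow> t < 0 \<Longrightarrow> \<psi> t \<in> closure U"
    by (rule exit_limit[of \<phi> U "\<lambda>_. 0" b p, OF sol open_U times_zero b(1,2) lim _ b(3)]) blast+
  have "V (\<psi> 0) \<le> enat Nstar"
    using psi(4) times_uminus[OF times_one]
    by (intro V_near_backward[OF outer[OF psi(1,3)], of "-1"]) auto
  moreover have "l \<le> V (\<psi> 0)"
    using \<phi>(3) e times_add by (intro V_limit_ge[OF outer_solution_shift[OF \<phi>(1) e] outer[OF psi(1,3)] psi(2)]) auto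
  moreover
  have "\<forall>n. \<exists>t. t \<in> \<T> \<and> t \<le> 0 \<and> \<phi> n t \<notin> U"
    using leaves[of "-1"] by simp
  then obtain a where a: "\<And>n. a n \<in> \<T>" "\<And>n. a n \<le> 0" "\<And>n. \<phi> n (a n) \<notin> U"
    by metis
  have "S \<delta> x \<noteq> p" if "\<delta> \<in> nonneg_times \<T>" "x \<in> \<A>" "x \<notin> U" for \<delta> x
    using complement_invariant[of \<delta> x] that p(1) O_subset_U by blast
  then obtain e r \<psi>' where e: "\<And>n. e n \<in> \<T>" and psi': "attractor_solution \<psi>'"
      "\<And>t. t \<in> \<T> \<Longrightarrow> (\<lambda>n. \<phi> (r n) (e (r n) + t)) \<longlonglongrightarrow> \<psi>' t"
      "\<psi>' 0 \<notin> U" "\<And>t. t \<in> \<T> \<Longrightarrow> 0 < t \<Longrightarrow> \<psi>' t \<in> closure U"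
    by (rule entrance_limit[of \<phi> U a "\<lambda>_. 0" p, OF sol open_U a(1) times_zero a(2,3) lim]) blast+
  have "enat Nstar \<le> V (\<psi>' 0)"
    using psi'(4) by (intro V_near_forward[OF outer[OF psi'(1,3)], of 1]) auto
  moreover have "V (\<psi>' 0) \<le> u"
    using \<phi>(4) e times_add
    by (intro V_limit_le[OF outer_solution_shift[OF \<phi>(1) e] outer[OF psi'(1,3)] times_zero psi'(2)]) auto
  \<comment> \<open>The exit limit gives \<open>l \<le> Nstar\<close> and the entrance limit
    \<open>Nstar \<le> u\<close>, so \<open>Nstar\<close> would lie in the band.\<close>
  ultimately show False
    using assms by auto
qed

text \<open>A limit solution stays in the closure of the band set, and so do its limit sets. That
  closure is disjoint from \<open>\<O>\<close>, which preserves the condition on limit sets; the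
  bounds on \<open>V\<close> pass to the limit.\<close>

lemma closed_band_set:
  assumes "\<O> = {} \<or> u < enat Nstar \<or> enat Nstar < l"
  shows "closed (band_set l u)"
  unfolding closed_sequential_limits
proof (intro allI impI, elim conjE)
  fix x \<xi> assume x: "\<forall>n. x n \<in> band_set l u" "x \<longlonglongrightarrow> \<xi>"
  have iso: "closure (band_set l u) \<inter> \<O> = {}"
    using assms band_set_isolated by blast
  have "\<forall>n. \<exists>\<phi>. outer_solution \<phi> \<and> \<phi> 0 = x n \<and> (\<forall>t\<in>\<T>. l \<le> V (\<phi> t) \<and> V (\<phi> t) \<le> u) \<and>
      (\<forall>\<sigma>\<in>{1, -1}. limit_set \<sigma> \<phi> \<inter> \<O> = {})"
    using x(1) by (auto simp: band_set_def)
  then obtain \<phi> where \<phi>: "\<And>n. outer_solution (\<phi> n)" "\<And>n. \<phi> n 0 = x n"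
      "\<And>n t. t \<in> \<T> \<Longrightarrow> l \<le> V (\<phi> n t)" "\<And>n t. t \<in> \<T> \<Longrightarrow> V (\<phi> n t) \<le> u"
      "\<And>n \<sigma>. \<sigma> \<in> {1, -1} \<Longrightarrow> limit_set \<sigma> (\<phi> n) \<inter> \<O> = {}"
    by metis
  obtain r \<psi> where r: "strict_mono r" and psi: "attractor_solution \<psi>"
      and lim: "\<And>t. t \<in> \<T> \<Longrightarrow> (\<lambda>n. \<phi> (r n) t) \<longlonglongrightarrow> \<psi> t"
    using attractor_solution_limit[of \<phi>] outer_solutionD(1)[OF \<phi>(1)] by metis
  have "\<psi> 0 = \<xi>"
    using LIMSEQ_unique[OF lim[OF times_zero]] LIMSEQ_subseq_LIMSEQ[OF x(2) r] by (simp add: o_def \<phi>(2))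
  have cl: "\<psi> t \<in> closure (band_set l u)" if t: "t \<in> \<T>" for t
    unfolding closure_sequential
    using band_set_solution[OF \<phi>(1,3,4,5) t] lim[OF t] by (intro exI[of _ "\<lambda>n. \<phi> (r n) t"]) auto
  have outer: "outer_solution \<psi>"
    using outer_solutionI[OF psi times_zero] cl[OF times_zero] iso by blast
  have "limit_set \<sigma> \<psi> \<subseteq> closure (band_set l u)" for \<sigma>
    using cl by (intro limit_set_subset[of _ 0]) auto
  then have "limit_set \<sigma> \<psi> \<inter> \<O> = {}" for \<sigma>
    using iso by blast
  moreover have "l \<le> V (\<psi> t)" "V (\<psi> t) \<le> u" if t: "t \<in> \<T>" for t
    using V_limit_ge[of "\<lambda>n. \<phi> (r n)", OF \<phi>(1) outer lim t \<phi>(3)]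
      V_limit_le[of "\<lambda>n. \<phi> (r n)", OF \<phi>(1) outer t lim[OF t] \<phi>(4)[OF t]] by auto
  ultimately show "\<xi> \<in> band_set l u"
    unfolding band_set_def using outer \<open>\<psi> 0 = \<xi>\<close> by blast
qed

text \<open>Limit points in \<open>\<O>\<close> belong to the set. Near a limit point off the closed
  set \<open>\<O>\<close> only members of \<open>critical_set\<close> remain, and the constant level
  passes to the limit solution without any separation from \<open>\<O>\<close>.\<close>

lemma closed_critical_level_set: "closed (\<O> \<union> critical_set)"
  unfolding closed_sequential_limits
proof (intro allI impI, elim conjE)
  fix x \<xi> assume x: "\<forall>n. x n \<in> \<O> \<union> critical_set" "x \<longlonglongrightarrow> \<xi>"
  show "\<xi> \<in> \<O> \<union> critical_set"
  proof (cases "\<xi> \<in> \<O>")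
    case False
    then have "\<forall>\<^sub>F n in sequentially. x n \<in> - \<O>"
      using closed_O by (intro topological_tendstoD[OF x(2)]) auto
    then obtain N where "\<And>n. n \<ge> N \<Longrightarrow> x n \<in> - \<O>"
      by (auto simp: eventually_sequentially)
    then have "x (n + N) \<in> critical_set" for n
      using x(1) by (metis ComplD UnE le_add2)
    then have "\<forall>n. \<exists>\<phi>. outer_solution \<phi> \<and> \<phi> 0 = x (n + N) \<and> (\<forall>t\<in>\<T>. V (\<phi> t) = enat Nstar)"
      by (simp add: critical_set_def)
    then obtain \<phi> where \<phi>: "\<And>n. outer_solution (\<phi> n)" "\<And>n. \<phi> n 0 = x (n + N)"
        "\<And>n t. t \<in> \<T> \<Longrightarrow> V (\<phi> n t) = enat Nstar"
      by metis
    obtain r \<psi> where r: "strict_mono r" and psi: "attractor_solution \<psi>"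
        and lim: "\<And>t. t \<in> \<T> \<Longrightarrow> (\<lambda>n. \<phi> (r n) t) \<longlonglongrightarrow> \<psi> t"
      using attractor_solution_limit[of \<phi>] outer_solutionD(1)[OF \<phi>(1)] by metis
    have "\<psi> 0 = \<xi>"
      using LIMSEQ_unique[OF lim[OF times_zero]]
        LIMSEQ_subseq_LIMSEQ[OF LIMSEQ_ignore_initial_segment[OF x(2), of N] r]
      by (simp add: o_def \<phi>(2))
    then have outer: "outer_solution \<psi>"
      using outer_solutionI[OF psi times_zero] False by simp
    have "V (\<psi> t) = enat Nstar" if t: "t \<in> \<T>" for t
      using \<phi>(3) by (intro V_limit_eq[of "\<lambda>n. \<phi> (r n)", OF \<phi>(1) outer lim _ t]) auto
    then show ?thesis
      using outer \<open>\<psi> 0 = \<xi>\<close> by (auto simp: critical_set_def)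
  qed auto
qed

section \<open>The listed family and the dynamics between its members\<close>

context
  fixes N0 :: nat
  assumes N0: "\<O> \<noteq> {} \<Longrightarrow> Nstar < N0"
begin

abbreviation morse :: "nat \<Rightarrow> 'x set" where
  "morse \<equiv> morse_set \<T> S \<A> \<O> D V Nstar N0"

lemma morse_critical: "\<O> \<noteq> {} \<Longrightarrow> morse Nstar = \<O> \<union> critical_set"
  using N0 by (simp add: morse_set_def critical_level_set_eq)

lemma morse_level: "n < N0 \<Longrightarrow> \<O> = {} \<or> n \<noteq> Nstar \<Longrightarrow> morse n = band_set (enat n) (enat n)"
  by (auto simp: morse_set_def level_set_eq)

lemma morse_upper: "morse N0 = band_set (enat N0) \<infinity>"
  by (simp add: morse_set_def upper_level_set_eq)

lemma morse_cases:
  assumes "n \<le> N0"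
  obtains (critical) "\<O> \<noteq> {}" "n = Nstar" "morse n = \<O> \<union> critical_set"
  | (band) u where "\<O> = {} \<or> n \<noteq> Nstar" "morse n = band_set (enat n) u" "n < N0 \<and> u = enat n \<or> n = N0 \<and> u = \<infinity>"
proof (cases "\<O> \<noteq> {} \<and> n = Nstar")
  case True
  then show thesis
    using critical morse_critical by blast
next
  case False
  then show thesis
    using band morse_level morse_upper assms by (cases "n < N0") auto
qed

lemma morse_compact_invariant:
  assumes "n \<le> N0"
  shows "compact (morse n) \<and> invariant_set \<T> S (morse n) \<and> morse n \<subseteq> \<A>"
  using assms
proof (cases rule: morse_cases)
  case critical
  have "morse n \<subseteq> \<A>"
    using critical O_subset critical_set_subset by auto
  moreover from this have "compact (morse n)"
    using closed_critical_level_set compact_attractor critical(3)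
    by (metis compact_Int_closed inf.absorb_iff2)
  moreover have "invariant_set \<T> S (morse n)"
    using critical(3) invariant_O invariant_critical_set by (simp add: invariant_set_def image_Un)
  ultimately show ?thesis
    by blast
next
  case (band u)
  have "morse n \<subseteq> \<A>"
    using band band_set_subset by blast
  \<comment> \<open>A single level \<open>n \<noteq> Nstar\<close> lies strictly on one side of
    \<open>Nstar\<close>; the top band starts at \<open>N0\<close>, above \<open>Nstar\<close> when
    \<open>\<O>\<close> is nonempty.\<close>
  moreover have "closed (morse n)"
    unfolding band(2) using band N0 by (intro closed_band_set) force
  ultimately show ?thesis
    using band(2) invariant_band_set compact_attractor
    by (metis compact_Int_closed inf.absorb_iff2)
qed

lemma morse_value:
  assumes "n \<le> N0" "x \<in> morse n" "x \<notin> \<O>"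
  shows "n < N0 \<Longrightarrow> V x = enat n" "n = N0 \<Longrightarrow> enat N0 \<le> V x"
proof -
  have "(n < N0 \<longrightarrow> V x = enat n) \<and> (n = N0 \<longrightarrow> enat N0 \<le> V x)"
    using assms(1)
  proof (cases rule: morse_cases)
    case critical
    then obtain \<phi> where "\<phi> 0 = x" "\<forall>t\<in>\<T>. V (\<phi> t) = enat Nstar"
      using assms(2,3) by (auto simp: critical_set_def)
    then show ?thesis
      using critical N0 times_zero by auto
  next
    case (band u)
    then obtain \<phi> where "\<phi> 0 = x" "\<forall>t\<in>\<T>. enat n \<le> V (\<phi> t) \<and> V (\<phi> t) \<le> u"
      using assms(2) by (auto simp: band_set_def)
    then have "enat n \<le> V x" "V x \<le> u"
      using times_zero by auto
    with band(3) show ?thesis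
      by (auto intro: antisym)
  qed
  then show "n < N0 \<Longrightarrow> V x = enat n" "n = N0 \<Longrightarrow> enat N0 \<le> V x"
    by auto
qed

lemma morse_meets_O:
  assumes "n \<le> N0" "x \<in> morse n" "x \<in> \<O>"
  shows "n = Nstar"
  using assms(1)
proof (cases rule: morse_cases)
  case (band u)
  then show ?thesis
    using assms band_set_subset by blast
qed

text \<open>Off \<open>\<O>\<close> the value of \<open>V\<close> at a point, capped at
  \<open>N0\<close>, determines the index; on \<open>\<O>\<close> the only possible index is
  \<open>Nstar\<close>.\<close>

lemma morse_disjoint:
  assumes "i \<le> N0" "j \<le> N0" "i \<noteq> j"
  shows "morse i \<inter> morse j = {}"
proof -
  have False if x: "x \<in> morse i" "x \<in> morse j" for x
  proof (cases "x \<in> \<O>")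
    case True
    then show False
      using morse_meets_O assms x by blast
  next
    case False
    show False
      using morse_value[OF assms(1) x(1) False] morse_value[OF assms(2) x(2) False] assms
      by (cases "i < N0"; cases "j < N0") auto
  qed
  then show ?thesis
    by blast
qed

text \<open>The capped value encodes both kinds of band in one equation: it means
  \<open>V = n\<close> for \<open>n < N0\<close> and \<open>N0 \<le> V\<close> for
  \<open>n = N0\<close>.\<close>

lemma solution_in_morse:
  assumes "outer_solution \<psi>" "n \<le> N0"
    and "\<And>t. t \<in> \<T> \<Longrightarrow> min (V (\<psi> t)) (enat N0) = enat n"
    and "\<O> \<noteq> {} \<and> n = Nstar \<or> (\<forall>\<sigma>\<in>{1, -1}. limit_set \<sigma> \<psi> \<inter> \<O> = {})" "t \<in> \<T>"
  shows "\<psi> t \<in> morse n"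
proof -
  have low: "enat n \<le> V (\<psi> t)" if "t \<in> \<T>" for t
    using assms(3)[OF that] by (metis min.cobounded1)
  have high: "V (\<psi> t) = enat n" if "t \<in> \<T>" "n < N0" for t
    using assms(3)[OF that(1)] that(2) by (auto simp: min_def split: if_splits)
  from assms(2) show ?thesis
  proof (cases rule: morse_cases)
    case critical
    then show ?thesis
      using critical_set_solution[OF assms(1) _ assms(5)] high N0 by auto
  next
    case (band u)
    have disj: "limit_set \<sigma> \<psi> \<inter> \<O> = {}" if "\<sigma> \<in> {1, -1}" for \<sigma>
    proof -
      have "\<not> (\<O> \<noteq> {} \<and> n = Nstar)"
        using band(1) by simp
      with assms(4) have "\<forall>\<sigma>\<in>{1, -1}. limit_set \<sigma> \<psi> \<inter> \<O> = {}"
        by argo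
      then show ?thesis
        using that by (rule bspec)
    qed
    have up: "V (\<psi> t) \<le> u" if "t \<in> \<T>" for t
      using band(3) high[OF that] by (cases "n < N0") simp_all
    show ?thesis
      unfolding band(2) by (rule band_set_solution[OF assms(1) low up disj assms(5)])
  qed
qed

text \<open>The index of the Morse set that contains the limit set. It is set to
  \<open>Nstar\<close> whenever \<open>\<O>\<close> is met, since \<open>limit_set_meets_O\<close>
  does not determine \<open>V_end\<close> for limit sets inside \<open>\<O>\<close>. The cap makes
  the argument of \<open>the_enat\<close> finite.\<close>

definition end_index :: "real \<Rightarrow> (real \<Rightarrow> 'x) \<Rightarrow> nat" where
  "end_index \<sigma> \<phi> =
     (if limit_set \<sigma> \<phi> \<inter> \<O> \<noteq> {} then Nstar else the_enat (min (V_end \<sigma> \<phi>) (enat N0)))"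

lemma enat_end_index:
  assumes "limit_set \<sigma> \<phi> \<inter> \<O> = {}"
  shows "enat (end_index \<sigma> \<phi>) = min (V_end \<sigma> \<phi>) (enat N0)"
  using assms by (cases "V_end \<sigma> \<phi>") (auto simp: end_index_def min_def)

lemma end_index_meets: "limit_set \<sigma> \<phi> \<inter> \<O> \<noteq> {} \<Longrightarrow> end_index \<sigma> \<phi> = Nstar"
  by (simp add: end_index_def)

lemma end_index_le: "end_index \<sigma> \<phi> \<le> N0"
proof (cases "limit_set \<sigma> \<phi> \<inter> \<O> = {}")
  case True
  then show ?thesis
    using enat_end_index[OF True] by (metis enat_ord_simps(1) min.cobounded2)
next
  case False
  then show ?thesis
    using N0 end_index_meets[of \<sigma> \<phi>] by force
qed

text \<open>A limit point off \<open>\<O>\<close> lies on a solution \<open>\<psi>\<close> inside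
  the limit set, at the end value. If the limit set avoids \<open>\<O>\<close>, so do the limit sets
  of \<open>\<psi>\<close>, which it contains; otherwise the end value is \<open>Nstar\<close>,
  where no such condition is imposed.\<close>

lemma limit_set_in_morse:
  assumes \<phi>: "outer_solution \<phi>" and \<sigma>: "\<sigma> \<in> {1, -1}"
  shows "limit_set \<sigma> \<phi> \<subseteq> morse (end_index \<sigma> \<phi>)"
proof
  fix \<eta> assume \<eta>: "\<eta> \<in> limit_set \<sigma> \<phi>"
  show "\<eta> \<in> morse (end_index \<sigma> \<phi>)"
  proof (cases "\<eta> \<in> \<O>")
    case True
    then have "limit_set \<sigma> \<phi> \<inter> \<O> \<noteq> {}" "\<O> \<noteq> {}"
      using \<eta> by blast+
    then show ?thesis
      using True morse_critical end_index_meets[of \<sigma> \<phi>] by simp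
  next
    case False
    then obtain \<psi> where psi: "outer_solution \<psi>" "\<psi> 0 = \<eta>" "\<And>t. t \<in> \<T> \<Longrightarrow> \<psi> t \<in> limit_set \<sigma> \<phi>"
        "\<And>t. t \<in> \<T> \<Longrightarrow> V (\<psi> t) = V_end \<sigma> \<phi>"
      using limit_set_level[OF \<phi> \<sigma> \<eta>] by metis
    have sub: "limit_set \<sigma>' \<psi> \<subseteq> limit_set \<sigma> \<phi>" for \<sigma>'
      using closed_limit_set psi(3) by (intro limit_set_subset[of _ 0]) auto
    have "min (V_end \<sigma> \<phi>) (enat N0) = enat (end_index \<sigma> \<phi>) \<and>
      (\<O> \<noteq> {} \<and> end_index \<sigma> \<phi> = Nstar \<or> (\<forall>\<sigma>'\<in>{1, -1}. limit_set \<sigma>' \<psi> \<inter> \<O> = {}))"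
    proof (cases "limit_set \<sigma> \<phi> \<inter> \<O> = {}")
      case True
      then show ?thesis
        using enat_end_index[OF True] sub by auto
    next
      case meets: False
      then have "V_end \<sigma> \<phi> = enat Nstar"
        using limit_set_meets_O[OF \<phi> \<sigma>] \<eta> False by blast
      moreover have "\<O> \<noteq> {}"
        using meets by blast
      ultimately show ?thesis
        using end_index_meets[OF meets] N0 by (simp add: min_def)
    qed
    then show ?thesis
      using solution_in_morse[OF psi(1) end_index_le _ _ times_zero] psi(2,4) by metis
  qed
qed

text \<open>Monotonicity of \<open>V\<close> orders the two end values, and capping preserves the
  order. If just one limit set meets \<open>\<O>\<close>, its index \<open>Nstar\<close> is compared
  with the other end value by \<open>omega_meets_O\<close> or \<open>alpha_meets_O\<close>.\<close>

lemma end_index_mono: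
  assumes \<phi>: "outer_solution \<phi>"
  shows "end_index 1 \<phi> \<le> end_index (-1) \<phi>"
proof -
  have le: "V_end 1 \<phi> \<le> V_end (-1) \<phi>"
    using V_end_bounds[OF times_zero] order_trans by blast
  have N: "enat Nstar \<le> enat N0" if "limit_set \<sigma> \<phi> \<inter> \<O> \<noteq> {}" for \<sigma>
    using N0 that by force
  consider (both) "limit_set 1 \<phi> \<inter> \<O> \<noteq> {}" "limit_set (-1) \<phi> \<inter> \<O> \<noteq> {}"
    | (fwd) "limit_set 1 \<phi> \<inter> \<O> \<noteq> {}" "limit_set (-1) \<phi> \<inter> \<O> = {}"
    | (bwd) "limit_set 1 \<phi> \<inter> \<O> = {}" "limit_set (-1) \<phi> \<inter> \<O> \<noteq> {}"
    | (none) "limit_set 1 \<phi> \<inter> \<O> = {}" "limit_set (-1) \<phi> \<inter> \<O> = {}"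
    by blast
  then show ?thesis
  proof cases
    case both
    then show ?thesis
      by (simp add: end_index_meets)
  next
    case fwd
    have "enat Nstar \<le> V_end (-1) \<phi>"
      using omega_meets_O[OF \<phi> fwd(1)] V_end_ge by blast
    then show ?thesis
      using N[OF fwd(1)] enat_end_index[OF fwd(2)] end_index_meets[OF fwd(1)]
      by (metis enat_ord_simps(1) min.boundedI)
  next
    case bwd
    have "V_end 1 \<phi> \<le> enat Nstar"
      using alpha_meets_O[OF \<phi> bwd(2)] V_end_le by blast
    then show ?thesis
      using enat_end_index[OF bwd(1)] end_index_meets[OF bwd(2)]
      by (metis enat_ord_simps(1) min.coboundedI1)
  next
    case none
    then show ?thesis
      using enat_end_index[OF none(1)] enat_end_index[OF none(2)] le
      by (metis enat_ord_simps(1) min.mono order_refl)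
  qed
qed

text \<open>The forward index bounds the capped value of \<open>V\<close> from below and the
  backward index from above, at every time; equality makes it constant.\<close>

lemma end_index_eq:
  assumes \<phi>: "outer_solution \<phi>" and eq: "end_index 1 \<phi> = end_index (-1) \<phi>" and t: "t \<in> \<T>"
  shows "\<phi> t \<in> morse (end_index 1 \<phi>)"
proof -
  let ?n = "end_index 1 \<phi>"
  have N: "enat Nstar < enat N0" if "limit_set \<sigma> \<phi> \<inter> \<O> \<noteq> {}" for \<sigma>
    using N0 that by force
  have low: "enat ?n \<le> min (V (\<phi> s)) (enat N0)" if s: "s \<in> \<T>" for s
  proof (cases "limit_set 1 \<phi> \<inter> \<O> = {}")
    case True
    then show ?thesis
      using enat_end_index[OF True] V_end_bounds(1)[OF s, of \<phi>] by (simp add: min.coboundedI1)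
  next
    case False
    then show ?thesis
      using omega_meets_O[OF \<phi> False s] end_index_meets[OF False] N[OF False] by simp
  qed
  have high: "min (V (\<phi> s)) (enat N0) \<le> enat ?n" if s: "s \<in> \<T>" for s
  proof (cases "limit_set (-1) \<phi> \<inter> \<O> = {}")
    case True
    then show ?thesis
      using enat_end_index[OF True] V_end_bounds(2)[OF s, of \<phi>] eq
      by (metis min.mono order_refl)
  next
    case False
    then show ?thesis
      using alpha_meets_O[OF \<phi> False s] end_index_meets[OF False] eq by (simp add: min.coboundedI1)
  qed
  have "\<O> \<noteq> {} \<and> ?n = Nstar \<or> (\<forall>\<sigma>\<in>{1, -1}. limit_set \<sigma> \<phi> \<inter> \<O> = {})"
    using end_index_meets[of 1 \<phi>] end_index_meets[of "-1" \<phi>] eq by auto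
  then show ?thesis
    using solution_in_morse[OF \<phi> end_index_le _ _ t] low high by (metis antisym)
qed

text \<open>A solution that is not outer lies wholly in \<open>\<O>\<close>, hence with both limit
  sets in the critical Morse set; otherwise the end indices serve as \<open>N\<close> and
  \<open>K\<close>.\<close>

lemma solution_dynamics:
  assumes \<phi>: "attractor_solution \<phi>"
  shows "\<exists>N\<le>N0. \<exists>K\<le>N0. N \<le> K \<and> limit_set (-1) \<phi> \<subseteq> morse K \<and> limit_set 1 \<phi> \<subseteq> morse N \<and>
    (N = K \<longrightarrow> (\<forall>t\<in>\<T>. \<phi> t \<in> morse N))"
proof (cases "outer_solution \<phi>")
  case True
  then show ?thesis
    using end_index_le[of 1 \<phi>] end_index_le[of "-1" \<phi>] end_index_mono end_index_eq
      limit_set_in_morse[OF True, of 1] limit_set_in_morse[OF True, of "-1"]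
    by (intro exI[of _ "end_index 1 \<phi>"] exI[of _ "end_index (-1) \<phi>"] conjI) auto
next
  case False
  then have O: "\<And>t. t \<in> \<T> \<Longrightarrow> \<phi> t \<in> \<O>"
    using outer_solutionI[OF \<phi>] by blast
  then have "\<O> \<noteq> {}"
    using times_zero by blast
  moreover have "limit_set \<sigma> \<phi> \<subseteq> \<O>" for \<sigma>
    using O closed_O by (intro limit_set_subset[of _ 0]) auto
  ultimately show ?thesis
    using O N0 morse_critical by (intro exI[of _ Nstar] conjI) auto
qed

text \<open>Limit sets are nonempty, so the Morse sets containing them survive when empty members
  are dropped. A solution through a point of \<open>\<A>\<close> shows that some member
  remains.\<close>

lemma listed_morse_decomposition_morse:
  assumes "\<A> \<noteq> {}"
  shows "listed_morse_decomposition \<T> S \<A> N0 morse"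
proof -
  let ?I = "{n \<in> {0..N0}. morse n \<noteq> {}}"
  have dyn: "\<exists>N\<in>?I. \<exists>K\<in>?I. N \<le> K \<and> alpha_limit \<T> \<phi> \<subseteq> morse K \<and> omega_limit \<T> S \<xi> \<subseteq> morse N \<and>
      (N = K \<longrightarrow> (\<forall>t\<in>\<T>. \<phi> t \<in> morse N))" if "bounded_entire_solution_through \<T> S \<xi> \<phi>" for \<xi> \<phi>
  proof -
    have \<phi>: "attractor_solution \<phi>" "\<phi> 0 = \<xi>"
      using that by (auto simp: bounded_entire_solution_through_iff)
    obtain N K where *: "N \<le> N0" "K \<le> N0" "N \<le> K" "limit_set (-1) \<phi> \<subseteq> morse K" "limit_set 1 \<phi> \<subseteq> morse N"
      "N = K \<longrightarrow> (\<forall>t\<in>\<T>. \<phi> t \<in> morse N)"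
      using solution_dynamics[OF \<phi>(1)] by blast
    moreover have "morse K \<noteq> {}" "morse N \<noteq> {}"
      using * limit_set_nonempty[OF \<phi>(1), of 1] limit_set_nonempty[OF \<phi>(1), of "-1"] by auto
    ultimately show ?thesis
      using alpha_limit_eq[of \<phi>] omega_limit_eq[OF \<phi>(1)] \<phi>(2)
      by (intro bexI[of _ N] bexI[of _ K]) auto
  qed
  obtain \<xi> \<phi> where "attractor_solution \<phi>" "\<phi> 0 = \<xi>"
    using assms attractor_solution_exists by blast
  then have "?I \<noteq> {}"
    using dyn[of \<xi> \<phi>] by (auto simp: bounded_entire_solution_through_iff)
  then show ?thesis
    unfolding listed_morse_decomposition_def morse_decomposition_def
    using morse_compact_invariant morse_disjoint dyn by (intro conjI ballI allI impI) auto
qed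

end

end

text \<open>For empty \<open>\<A>\<close> every listed set is empty, which the convention on lists
  excludes; hence \<open>attractor_nonempty\<close>. The hypothesis
  \<open>complement_pos_invariant\<close> ensures that a solution in \<open>\<A>\<close> that is
  once off \<open>\<O>\<close> never enters \<open>\<O>\<close>, so that the conditions on
  \<open>V\<close> apply along all of it.\<close>

theorem theorem3p1:
  fixes \<T> :: "real set"
    and S :: "real \<Rightarrow> 'x::metric_space \<Rightarrow> 'x"
    and \<A> \<O> Xt D \<R> :: "'x set"
    and dt :: "'x \<Rightarrow> 'x \<Rightarrow> real"
    and V :: "'x \<Rightarrow> enat"
    and Nstar N0 :: nat
  assumes time: "\<T> = UNIV \<or> \<T> = \<int>"
    and sds: "semi_dynamical_system \<T> S"
    and attractor: "global_attractor \<T> S \<A>"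
    and attractor_nonempty: "\<A> \<noteq> {}"
    and H1: "\<O> \<subseteq> \<A>" "compact \<O>" "invariant_set \<T> S \<O>"
    and complement_pos_invariant: "\<And>t \<xi>. t \<in> nonneg_times \<T> \<Longrightarrow> \<xi> \<in> \<A> - \<O> \<Longrightarrow> S t \<xi> \<notin> \<O>"
    and H2: "\<And>t. t \<in> nonneg_times \<T> \<Longrightarrow> S t ` Xt \<subseteq> Xt" "\<A> \<subseteq> Xt"
    and H3: "Metric_space Xt dt"
      "\<And>x \<xi>. (\<And>n::nat. x n \<in> Xt) \<Longrightarrow> \<xi> \<in> Xt \<Longrightarrow> (\<lambda>n. dt (x n) \<xi>) \<longlonglongrightarrow> 0 \<Longrightarrow> x \<longlonglongrightarrow> \<xi>"
    and H4: "\<And>x \<xi>. (\<And>n::nat. x n \<in> \<A>) \<Longrightarrow> \<xi> \<in> \<A> \<Longrightarrow> x \<longlonglongrightarrow> \<xi> \<Longrightarrow>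
      \<exists>r::nat \<Rightarrow> nat. strict_mono r \<and> (\<lambda>k. dt (x (r k)) \<xi>) \<longlonglongrightarrow> 0"
    and dom: "- \<O> \<subseteq> D"
    and V1: "\<And>x \<xi>. (\<And>n::nat. x n \<notin> \<O>) \<Longrightarrow> \<xi> \<notin> \<O> \<Longrightarrow> x \<longlonglongrightarrow> \<xi> \<Longrightarrow>
      V \<xi> \<le> liminf (\<lambda>n. V (x n))"
    and V2: "\<R> \<subseteq> Xt - \<O>"
      "\<And>x \<xi>. (\<And>n::nat. x n \<in> Xt - \<O>) \<Longrightarrow> \<xi> \<in> \<R> \<Longrightarrow> (\<lambda>n. dt (x n) \<xi>) \<longlonglongrightarrow> 0 \<Longrightarrow>
      (\<lambda>n. V (x n)) \<longlonglongrightarrow> V \<xi>"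
    and V3: "\<And>t \<xi>. t \<in> nonneg_times \<T> \<Longrightarrow> \<xi> \<notin> \<O> \<Longrightarrow> S t \<xi> \<in> D \<and> V (S t \<xi>) \<le> V \<xi>"
    and V4: "\<exists>T\<in>nonneg_times \<T>. \<forall>t\<in>nonneg_times \<T>. \<forall>\<xi>.
      T \<le> t \<longrightarrow> \<xi> \<notin> \<O> \<longrightarrow> V (S t \<xi>) = V \<xi> \<longrightarrow> S t \<xi> \<in> \<R>"
    and V5: "\<O> \<noteq> {} \<Longrightarrow> \<exists>U. open U \<and> \<O> \<subseteq> U \<and>
      (\<forall>\<phi>. entire_solution \<T> S \<phi> \<longrightarrow> (\<forall>t\<in>\<T>. \<phi> t \<notin> \<O>) \<longrightarrow>
        ((\<exists>t0\<in>\<T>. \<forall>t\<in>\<T>. t \<le> t0 \<longrightarrow> \<phi> t \<in> closure U \<inter> \<A>) \<longrightarrow> (\<forall>t\<in>\<T>. V (\<phi> t) \<le> enat Nstar)) \<and>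
        ((\<exists>t1\<in>\<T>. \<forall>t\<in>\<T>. t1 \<le> t \<longrightarrow> \<phi> t \<in> closure U \<inter> \<A>) \<longrightarrow> (\<forall>t\<in>\<T>. enat Nstar \<le> V (\<phi> t))))"
    and N0: "\<O> \<noteq> {} \<Longrightarrow> Nstar < N0"
  shows "listed_morse_decomposition \<T> S \<A> N0 (morse_set \<T> S \<A> \<O> D V Nstar N0)"
proof -
  define near where "near U \<longleftrightarrow> (\<forall>\<phi>. entire_solution \<T> S \<phi> \<longrightarrow> (\<forall>t\<in>\<T>. \<phi> t \<notin> \<O>) \<longrightarrow>
        ((\<exists>t0\<in>\<T>. \<forall>t\<in>\<T>. t \<le> t0 \<longrightarrow> \<phi> t \<in> closure U \<inter> \<A>) \<longrightarrow> (\<forall>t\<in>\<T>. V (\<phi> t) \<le> enat Nstar)) \<and>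
        ((\<exists>t1\<in>\<T>. \<forall>t\<in>\<T>. t1 \<le> t \<longrightarrow> \<phi> t \<in> closure U \<inter> \<A>) \<longrightarrow> (\<forall>t\<in>\<T>. enat Nstar \<le> V (\<phi> t))))"
    for U
  have "\<exists>U. open U \<and> \<O> \<subseteq> U \<and> near U"
  proof (cases "\<O> = {}")
    case True
    \<comment> \<open>Here (V5) provides no neighbourhood. With \<open>U = {}\<close> both premises
      of \<open>near\<close> fail, already at the time \<open>t0\<close> or \<open>t1\<close>
      itself.\<close>
    have "near {}"
      by (auto simp: near_def)
    with True show ?thesis
      by (intro exI[of _ "{}"]) simp
  next
    case False
    then show ?thesis
      unfolding near_def by (rule V5)
  qed
  then obtain U where U: "open U" "\<O> \<subseteq> U" "near U"
    by blast
  interpret lyapunov_semiflow \<T> S \<A> \<O> Xt D \<R> U dt V Nstar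
  proof unfold_locales
    show "\<And>\<phi> t0 t. entire_solution \<T> S \<phi> \<Longrightarrow> (\<And>t. t \<in> \<T> \<Longrightarrow> \<phi> t \<notin> \<O>) \<Longrightarrow> t0 \<in> \<T> \<Longrightarrow>
        (\<And>t. t \<in> \<T> \<Longrightarrow> t \<le> t0 \<Longrightarrow> \<phi> t \<in> closure U \<inter> \<A>) \<Longrightarrow> t \<in> \<T> \<Longrightarrow> V (\<phi> t) \<le> enat Nstar"
      using U(3) unfolding near_def by meson
    show "\<And>\<phi> t1 t. entire_solution \<T> S \<phi> \<Longrightarrow> (\<And>t. t \<in> \<T> \<Longrightarrow> \<phi> t \<notin> \<O>) \<Longrightarrow> t1 \<in> \<T> \<Longrightarrow>
        (\<And>t. t \<in> \<T> \<Longrightarrow> t1 \<le> t \<Longrightarrow> \<phi> t \<in> closure U \<inter> \<A>) \<Longrightarrow> t \<in> \<T> \<Longrightarrow> enat Nstar \<le> V (\<phi> t)"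
      using U(3) unfolding near_def by meson
  qed (fact time sds attractor H1 complement_pos_invariant H2(2) H4 dom V1 V2(2) V3[THEN conjunct2] V4 U(1,2))+
  show ?thesis
    using listed_morse_decomposition_morse[OF N0 attractor_nonempty] .
qed

end
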